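(* Let $C\subset\mathbb{R}^d$ be a closed strictly convex integer cone with apex at $0$ and nonempty interior. Let $\mu$ be a polynomial valuation of degree $\le k$ on integer convex polytopes in $\mathbb{R}^d$, and let $A_1,\dots,A_n$ be $C$-coconvex integer polytopes. The number $$E(m_1,\dots,m_n)=\mu(m_1A_1\oplus m_2A_2\oplus\cdots\oplus m_nA_n)$$ is defined for any choice of positive integers $m_1,\dots,m_n$, and depends polynomially (of degree $\le k+d$) on $m_1,\dots,m_n$.
   Context: A cone is strictly convex if it is convex and contains no line. An integer cone is a cone of the form $\{t_1v_1+\dots+t_nv_n: t_i\ge 0\}$ with $v_i\in\mathbb{Z}^d$. A $C$-coconvex integer polytope is a set $A=C\setminus(\Delta_A\cup\{0\})$, where $\Delta_A\subset C$ is a closed convex set such that $C\setminus\Delta_A$ is bounded and nonempty and all vertices (extreme points) of $\Delta_A$ belong to $\mathbb{Z}^d$. For such $A,B$, $A\oplus B=C\setminus((\Delta_A+\Delta_B)\cup\{0\})$ with $+$ the Minkowski sum; $mA=\{ma:a\in A\}$. A convex integer polytope is a convex polytope all of whose vertices are in $\mathbb{Z}^d$ (possibly with empty interior). Let $\mathcal R_c(\mathbb{Z}^d)$ be the smallest ring of subsets of $\mathbb{R}^d$ containing all convex integer polytopes. A valuation on integer polytopes is a finitely additive (real-valued) measure on $\mathcal R_c(\mathbb{Z}^d)$. It is polynomial of degree $\le k$ if for every convex integer polytope $P$ the function $x\mapsto\mu(P+x)$ is a polynomial on $\mathbb{Z}^d$ of degree at most $k$. That $E$ "is defined" means that the set $m_1A_1\oplus\cdots\oplus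 m_nA_n$ belongs to $\mathcal R_c(\mathbb{Z}^d)$. *)

theory Defs
  imports "HOL-Analysis.Analysis"
begin

definition int_lattice :: "(real ^ 'd) set" where
  "int_lattice = {x. \<forall>i. x $ i \<in> \<int>}"

definition convex_integer_polytope :: "(real ^ 'd) set \<Rightarrow> bool" where
  "convex_integer_polytope P \<longleftrightarrow> polytope P \<and> {v. v extreme_point_of P} \<subseteq> int_lattice"

definition integer_polytope_ring :: "(real ^ 'd) set set" where
  "integer_polytope_ring =
     \<Inter>{R. ring_of_sets UNIV R \<and> {P. convex_integer_polytope P} \<subseteq> R}"

definition integer_cone :: "(real ^ 'd) set \<Rightarrow> bool" where
  "integer_cone C \<longleftrightarrow>
     (\<exists>V. finite V \<and> V \<subseteq> int_lattice \<and>
          C = {(\<Sum>v\<in>V. t v *\<^sub>R v) | t :: real ^ 'd \<Rightarrow> real. \<forall>v\<in>V. 0 \<le> t v})"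

definition strictly_convex_cone :: "'a::real_vector set \<Rightarrow> bool" where
  "strictly_convex_cone C \<longleftrightarrow>
     cone C \<and> convex C \<and> \<not> (\<exists>a u. u \<noteq> 0 \<and> (\<forall>t::real. a + t *\<^sub>R u \<in> C))"

definition coconvex_complement :: "(real ^ 'd) set \<Rightarrow> (real ^ 'd) set \<Rightarrow> bool" where
  "coconvex_complement C D \<longleftrightarrow>
     D \<subseteq> C \<and> closed D \<and> convex D \<and> bounded (C - D) \<and> C - D \<noteq> {} \<and>
     {v. v extreme_point_of D} \<subseteq> int_lattice"

definition coconvex_integer_polytope :: "(real ^ 'd) set \<Rightarrow> (real ^ 'd) set \<Rightarrow> bool" where
  "coconvex_integer_polytope C A \<longleftrightarrow> (\<exists>D. coconvex_complement C D \<and> A = C - (D \<union> {0}))"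

(* The set \<Delta>_A; it is determined by A, see complement_of_eq below. *)
definition complement_of :: "(real ^ 'd) set \<Rightarrow> (real ^ 'd) set \<Rightarrow> (real ^ 'd) set" where
  "complement_of C A = (THE D. coconvex_complement C D \<and> A = C - (D \<union> {0}))"

lemma zero_notin_coconvex_complement:
  assumes "cone C" "coconvex_complement C D"
  shows "0 \<notin> D"
proof
  assume z: "0 \<in> D"
  from assms(2) obtain x where x: "x \<in> C" "x \<notin> D"
    unfolding coconvex_complement_def by blast
  then have nz: "norm x > 0" using z by auto
  from assms(2) obtain b where b: "\<And>y. y \<in> C - D \<Longrightarrow> norm y \<le> b"
    unfolding coconvex_complement_def bounded_iff by blast
  define s where "s = max 1 ((b + 1) / norm x)"
  have s: "s \<ge> 1" by (simp add: s_def)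
  have "(b + 1) / norm x \<le> s" by (simp add: s_def)
  then have "b < norm (s *\<^sub>R x)" using nz s by (simp add: divide_le_eq)
  moreover have "s *\<^sub>R x \<in> C" using assms(1) x s by (simp add: cone_def)
  ultimately have "s *\<^sub>R x \<in> D" using b by force
  moreover have "convex D" using assms(2) by (simp add: coconvex_complement_def)
  ultimately have "(1 / s) *\<^sub>R (s *\<^sub>R x) + (1 - 1 / s) *\<^sub>R 0 \<in> D"
    using z s by (intro convexD) auto
  then show False using x s by simp
qed

lemma complement_of_eq:
  assumes "cone C" "coconvex_complement C D"
  shows "complement_of C (C - (D \<union> {0})) = D"
  unfolding complement_of_def
proof (rule the_equality)
  fix D' assume D': "coconvex_complement C D' \<and> C - (D \<union> {0}) = C - (D' \<union> {0})"
  then have "0 \<notin> D'" "D' \<subseteq> C" "0 \<notin> D" "D \<subseteq> C"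
    using assms zero_notin_coconvex_complement by (auto simp: coconvex_complement_def)
  with D' show "D' = D" by blast
qed (use assms in simp)

(* The operation A \<oplus> B; + is the Minkowski sum. *)
definition coconvex_sum ::
  "(real ^ 'd) set \<Rightarrow> (real ^ 'd) set \<Rightarrow> (real ^ 'd) set \<Rightarrow> (real ^ 'd) set" where
  "coconvex_sum C A B = C - ((complement_of C A + complement_of C B) \<union> {0})"

(* A 1 \<oplus> A 2 \<oplus> ... \<oplus> A n, bracketed to the left; meaningful for n \<ge> 1 only. *)
definition coconvex_sum_upto ::
  "(real ^ 'd) set \<Rightarrow> nat \<Rightarrow> (nat \<Rightarrow> (real ^ 'd) set) \<Rightarrow> (real ^ 'd) set" where
  "coconvex_sum_upto C n A = foldl (coconvex_sum C) (A 1) (map A [2..<Suc n])"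

(* On S, f is a real polynomial of total degree at most k in the coordinates
   X x i (i \<in> I) of the point x. The exponents a range over the finitely many
   functions from I to nat with sum at most k. *)
definition polynomial_deg_le_on ::
  "'i set \<Rightarrow> nat \<Rightarrow> ('x \<Rightarrow> 'i \<Rightarrow> real) \<Rightarrow> 'x set \<Rightarrow> ('x \<Rightarrow> real) \<Rightarrow> bool" where
  "polynomial_deg_le_on I k X S f \<longleftrightarrow>
     (\<exists>c. \<forall>x\<in>S. f x =
        (\<Sum>a\<in>{a \<in> I \<rightarrow>\<^sub>E {..k}. (\<Sum>i\<in>I. a i) \<le> k}. c a * (\<Prod>i\<in>I. X x i ^ a i)))"

definition integer_polytope_valuation :: "((real ^ 'd) set \<Rightarrow> real) \<Rightarrow> bool" where
  "integer_polytope_valuation \<mu> \<longleftrightarrow> Measure_Space.additive integer_polytope_ring \<mu>"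

definition polynomial_valuation :: "nat \<Rightarrow> ((real ^ 'd) set \<Rightarrow> real) \<Rightarrow> bool" where
  "polynomial_valuation k \<mu> \<longleftrightarrow>
     integer_polytope_valuation \<mu> \<and>
     (\<forall>P. convex_integer_polytope P \<longrightarrow>
        polynomial_deg_le_on UNIV k ($) int_lattice (\<lambda>x. \<mu> ((\<lambda>p. p + x) ` P)))"

end

theory Submission
  imports Defs
begin

text \<open>Fix an integer linear functional \<open>a\<close> that is positive on \<open>C - {0}\<close>. If the complement of
  \<open>\<Delta>\<^sub>i\<close> in \<open>C\<close> lies below the level \<open>L\<close> of \<open>a\<close>, then truncating \<open>\<Sigma> m\<^sub>i \<Delta>\<^sub>i\<close> at level \<open>\<Sigma> m\<^sub>i L\<close> gives
  \<open>\<Sigma> m\<^sub>i Q\<^sub>i\<close>, where \<open>Q\<^sub>i\<close> is \<open>\<Delta>\<^sub>i\<close> truncated at level \<open>L\<close>. For suitable \<open>L\<close> the \<open>Q\<^sub>i\<close> and the truncation \<open>P\<close>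
  of \<open>C\<close> are integer polytopes, and the set in question is \<open>(\<Sigma> m\<^sub>i P - \<Sigma> m\<^sub>i Q\<^sub>i) - {0}\<close>. It remains to
  show that \<open>\<mu> (\<Sigma> m\<^sub>i P\<^sub>i)\<close> is a polynomial in \<open>m\<close> of degree at most \<open>k + d\<close> for integer polytopes \<open>P\<^sub>i\<close>.

  A regular triangulation of the Cayley configuration of the \<open>P\<^sub>i\<close> cuts \<open>\<Sigma> m\<^sub>i P\<^sub>i\<close> into open cells
  that are direct sums of \<open>m\<^sub>i\<close>-fold open simplices. The types of the cells do not depend on \<open>m\<close>, and the
  dimensions of the simplices of a cell add up to at most \<open>d\<close>. Increasing \<open>m\<^sub>i\<close> by one replaces a cell
  by a translate along a vertex together with a cell in which the coordinate of this vertex is at most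
  one. Hence iterated differences in \<open>m\<close> reduce to differences under translation, and those vanish
  after \<open>k + 1\<close> steps.\<close>

section \<open>Polynomials and differences\<close>

text \<open>Triangulating each summand separately would not do, since sums of their cells overlap.
  The Cayley configuration puts the generators of different summands into independent label
  directions, and one triangulation then serves all \<open>m\<close> at once. Choosing it
  lexicographically avoids picking generic heights. As \<open>\<mu>\<close> is additive only on the
  ring generated by lattice polytopes, every half-open piece that is cut off must itself be built
  from lattice polytopes by differences and disjoint unions. The cutting ends because coefficients
  capped at one cannot have a large sum. For the degree: a cell with \<open>card \<tau>\<close>
  generators spread over all labels has dimension \<open>card \<tau> - card J\<close>; each
  generator beyond one per label permits one more summation over \<open>m\<close>, and translations
  account for \<open>k\<close>. The missing origin only changes the value by the constant
  \<open>\<mu> {0}\<close>.\<close>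

inductive monomial_sum :: "'i set \<Rightarrow> nat \<Rightarrow> (('i \<Rightarrow> nat) \<Rightarrow> real) \<Rightarrow> bool" for I e where
  zero: "monomial_sum I e (\<lambda>_. 0)"
| add_monomial: "monomial_sum I e f \<Longrightarrow> (\<Sum>i\<in>I. a i) < e \<Longrightarrow>
    monomial_sum I e (\<lambda>m. f m + c * (\<Prod>i\<in>I. real (m i) ^ a i))"

lemma monomial_sum_monomial:
  "(\<Sum>i\<in>I. a i) < e \<Longrightarrow> monomial_sum I e (\<lambda>m. c * (\<Prod>i\<in>I. real (m i) ^ a i))"
  using add_monomial[OF zero, of a I e c] by simp

lemma monomial_sum_add:
  assumes "monomial_sum I e f" "monomial_sum I e g"
  shows "monomial_sum I e (\<lambda>m. f m + g m)"
  using assms(2)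
proof induction
  case zero
  then show ?case using assms(1) by simp
next
  case (add_monomial g a c)
  from monomial_sum.add_monomial[OF add_monomial.IH add_monomial.hyps(2), of c]
  show ?case by (simp add: add.assoc)
qed

lemma monomial_sum_scale:
  assumes "monomial_sum I e f"
  shows "monomial_sum I e (\<lambda>m. b * f m)"
  using assms
proof induction
  case zero
  then show ?case by (simp add: monomial_sum.zero)
next
  case (add_monomial g a c)
  from monomial_sum.add_monomial[OF add_monomial.IH add_monomial.hyps(2), of "b * c"]
  show ?case by (simp add: algebra_simps)
qed

lemma monomial_sum_sum:
  assumes "finite T" "\<And>t. t \<in> T \<Longrightarrow> monomial_sum I e (f t)"
  shows "monomial_sum I e (\<lambda>m. \<Sum>t\<in>T. f t m)"
  using assms by (induction T) (auto intro: monomial_sum.zero monomial_sum_add)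

lemma monomial_sum_mono:
  assumes "monomial_sum I e f" "e \<le> e'"
  shows "monomial_sum I e' f"
  using assms by induction (auto intro: monomial_sum.intros)

text \<open>Fixing a coordinate at 1 amounts to replacing its exponent by 0, so no degree grows.
  This is used to walk from the all-one point to \<open>m\<close> one coordinate at a time.\<close>

lemma monomial_sum_freeze:
  assumes "monomial_sum I e f" "finite I"
  shows "monomial_sum I e (\<lambda>m. f (\<lambda>i. if i \<in> J then m i else 1))"
  using assms(1)
proof induction
  case zero
  then show ?case by (rule monomial_sum.zero)
next
  case (add_monomial g a c)
  let ?a = "\<lambda>i. if i \<in> J then a i else 0"
  have "(\<Sum>i\<in>I. ?a i) \<le> (\<Sum>i\<in>I. a i)" by (intro sum_mono) auto
  then have "(\<Sum>i\<in>I. ?a i) < e" using add_monomial.hyps by linarith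
  from monomial_sum.add_monomial[OF add_monomial.IH this, of c]
  have "monomial_sum I e (\<lambda>m. g (\<lambda>i. if i \<in> J then m i else 1) + c * (\<Prod>i\<in>I. real (m i) ^ ?a i))" .
  moreover have "(\<Prod>i\<in>I. real (m i) ^ ?a i) = (\<Prod>i\<in>I. real (if i \<in> J then m i else 1) ^ a i)" for m
    by (intro prod.cong) auto
  ultimately show ?case by simp
qed

text \<open>Telescope \<open>(t + 1)^(a + 1) - t^(a + 1)\<close>, expand by the binomial theorem and
  solve for the top power sum; the others are known by induction.\<close>

lemma power_sum_polynomial:
  "\<exists>b :: nat \<Rightarrow> real. \<forall>M\<ge>1. (\<Sum>t=1..<M. real t ^ a) = (\<Sum>l\<le>Suc a. b l * real M ^ l)"
proof (induction a rule: less_induct)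
  case (less a)
  then obtain b where b: "\<And>r M. r < a \<Longrightarrow> M \<ge> 1 \<Longrightarrow>
      (\<Sum>t=1..<M. real t ^ r) = (\<Sum>l\<le>Suc r. b r l * real M ^ l)"
    by metis
  \<comment> \<open>Zero padding gives all lower power sums the same index range.\<close>
  define b' where "b' r l = (if l \<le> Suc r then b r l else 0)" for r l
  have b': "(\<Sum>t=1..<M. real t ^ r) = (\<Sum>l\<le>Suc a. b' r l * real M ^ l)" if "r < a" "M \<ge> 1" for r M
    unfolding b[OF that] by (rule sum.mono_neutral_cong_left) (use that in \<open>auto simp: b'_def\<close>)
  \<comment> \<open>The coefficients of \<open>M^(a + 1) - 1\<close> minus the lower power sums
    weighted by binomials, divided by \<open>a + 1\<close>; the telescoped value at 1 is the
    \<open>- 1\<close> at \<open>l = 0\<close>.\<close>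
  define c where "c l = ((if l = Suc a then 1 else 0) - (if l = 0 then 1 else 0)
      - (\<Sum>r<a. real (Suc a choose r) * b' r l)) / real (Suc a)" for l
  have "(\<Sum>t=1..<M. real t ^ a) = (\<Sum>l\<le>Suc a. c l * real M ^ l)" if M: "M \<ge> 1" for M
  proof -
    have "real (M) ^ Suc a - 1 = (\<Sum>t=1..<M. real (Suc t) ^ Suc a - real t ^ Suc a)"
      using sum_Suc_diff'[of 1 M "\<lambda>t. real t ^ Suc a"] M by simp
    also have "\<dots> = (\<Sum>t=1..<M. \<Sum>r\<le>a. real (Suc a choose r) * real t ^ r)"
    proof (rule sum.cong)
      fix t
      have "real (Suc t) ^ Suc a = (real t + 1) ^ Suc a" by (simp add: add.commute)
      also have "\<dots> = (\<Sum>r\<le>Suc a. real (Suc a choose r) * real t ^ r)"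
        by (subst binomial_ring) simp
      also have "\<dots> = (\<Sum>r\<le>a. real (Suc a choose r) * real t ^ r) + real t ^ Suc a"
        by (subst sum.atMost_Suc) simp
      finally show "real (Suc t) ^ Suc a - real t ^ Suc a = (\<Sum>r\<le>a. real (Suc a choose r) * real t ^ r)"
        by simp
    qed simp
    also have "\<dots> = (\<Sum>r\<le>a. real (Suc a choose r) * (\<Sum>t=1..<M. real t ^ r))"
      by (subst sum.swap) (simp add: sum_distrib_left)
    also have "\<dots> = (\<Sum>r<a. real (Suc a choose r) * (\<Sum>t=1..<M. real t ^ r)) +
        real (Suc a) * (\<Sum>t=1..<M. real t ^ a)"
      by (simp add: lessThan_Suc_atMost[symmetric] del: of_nat_Suc)
    also have "(\<Sum>r<a. real (Suc a choose r) * (\<Sum>t=1..<M. real t ^ r)) =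
        (\<Sum>r<a. \<Sum>l\<le>Suc a. real (Suc a choose r) * b' r l * real M ^ l)"
      by (intro sum.cong refl, subst b') (use M in \<open>simp_all add: sum_distrib_left mult.assoc del: sum.atMost_Suc binomial_Suc_Suc\<close>)
    also have "\<dots> = (\<Sum>l\<le>Suc a. (\<Sum>r<a. real (Suc a choose r) * b' r l) * real M ^ l)"
      by (subst sum.swap) (simp add: sum_distrib_right del: sum.atMost_Suc)
    finally have *: "real (Suc a) * (\<Sum>t=1..<M. real t ^ a) =
      real M ^ Suc a - 1 - (\<Sum>l\<le>Suc a. (\<Sum>r<a. real (Suc a choose r) * b' r l) * real M ^ l)" by linarith
    have "real (Suc a) * (\<Sum>l\<le>Suc a. c l * real M ^ l) =
      (\<Sum>l\<le>Suc a. (real (Suc a) * c l) * real M ^ l)"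
      by (simp add: sum_distrib_left mult.assoc del: sum.atMost_Suc of_nat_Suc)
    also have "\<dots> = (\<Sum>l\<le>Suc a. (if l = Suc a then real M ^ l else 0) - (if l = 0 then real M ^ l else 0)
        - (\<Sum>r<a. real (Suc a choose r) * b' r l) * real M ^ l)"
      by (intro sum.cong refl) (simp add: c_def left_diff_distrib del: sum.atMost_Suc of_nat_Suc binomial_Suc_Suc)
    also have "\<dots> = real M ^ Suc a - 1 - (\<Sum>l\<le>Suc a. (\<Sum>r<a. real (Suc a choose r) * b' r l) * real M ^ l)"
      by (simp only: sum_subtractf sum.delta finite_atMost) simp
    finally have "real (Suc a) * (\<Sum>l\<le>Suc a. c l * real M ^ l) = real (Suc a) * (\<Sum>t=1..<M. real t ^ a)"
      unfolding * .
    then show ?thesis by (simp del: sum.atMost_Suc of_nat_Suc)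
  qed
  then show ?case by blast
qed

text \<open>Discrete integration in one variable: summation raises the exponent of
  \<open>m j\<close> by at most one and leaves the other factors alone.\<close>

lemma monomial_sum_indefinite_sum:
  assumes "monomial_sum I e f" "finite I" "j \<in> I"
  shows "\<exists>g. monomial_sum I (Suc e) g \<and> (\<forall>m. m j \<ge> 1 \<longrightarrow> (\<Sum>t=1..<m j. f (m(j := t))) = g m)"
  using assms(1)
proof induction
  case zero
  then show ?case by (auto intro!: exI[of _ "\<lambda>_. 0"] monomial_sum.zero)
next
  case (add_monomial f a c)
  then obtain g where g: "monomial_sum I (Suc e) g"
    "\<And>m. m j \<ge> 1 \<Longrightarrow> (\<Sum>t=1..<m j. f (m(j := t))) = g m" by blast
  obtain b :: "nat \<Rightarrow> real" where b: "\<And>M. M \<ge> 1 \<Longrightarrow> (\<Sum>t=1..<M. real t ^ a j) = (\<Sum>l\<le>Suc (a j). b l * real M ^ l)"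
    using power_sum_polynomial by blast
  let ?h = "\<lambda>m. \<Sum>l\<le>Suc (a j). (c * b l) * (\<Prod>i\<in>I. real (m i) ^ (a(j := l)) i)"
  have "monomial_sum I (Suc e) (\<lambda>m. (c * b l) * (\<Prod>i\<in>I. real (m i) ^ (a(j := l)) i))" if "l \<le> Suc (a j)" for l
  proof (rule monomial_sum_monomial)
    have "(\<Sum>i\<in>I. (a(j := l)) i) = l + (\<Sum>i\<in>I - {j}. a i)"
      using assms by (subst sum.remove[of _ j]) (auto intro!: sum.cong)
    moreover have "(\<Sum>i\<in>I. a i) = a j + (\<Sum>i\<in>I - {j}. a i)"
      using assms by (subst sum.remove[of _ j]) auto
    ultimately show "(\<Sum>i\<in>I. (a(j := l)) i) < Suc e" using that add_monomial.hyps by linarith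
  qed
  then have h: "monomial_sum I (Suc e) ?h" by (intro monomial_sum_sum) auto
  have split: "(\<Prod>i\<in>I. real ((m(j := t)) i) ^ (a(j := l)) i) = real t ^ l * (\<Prod>i\<in>I - {j}. real (m i) ^ a i)"
    for m :: "'a \<Rightarrow> nat" and t l
    using assms by (subst prod.remove[of _ j]) (auto intro!: prod.cong)
  have "(\<Sum>t=1..<m j. f (m(j := t)) + c * (\<Prod>i\<in>I. real ((m(j := t)) i) ^ a i)) = g m + ?h m"
    if m: "m j \<ge> 1" for m
  proof -
    have "(\<Sum>t=1..<m j. c * (\<Prod>i\<in>I. real ((m(j := t)) i) ^ a i)) =
        c * (\<Sum>t=1..<m j. real t ^ a j) * (\<Prod>i\<in>I - {j}. real (m i) ^ a i)"
      using split[of m _ "a j"] by (simp add: sum_distrib_left sum_distrib_right mult.assoc)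
    also have "\<dots> = ?h m"
      unfolding b[OF m] using split[of m "m j"]
      by (simp add: sum_distrib_left sum_distrib_right mult.assoc del: sum.atMost_Suc)
    finally show ?thesis unfolding sum.distrib g(2)[of m, OF m] by simp
  qed
  then show ?case using monomial_sum_add[OF g(1) h] by blast
qed

lemma monomial_sum_polynomial_deg_le_on:
  assumes "monomial_sum I (Suc D) f" "finite I" "\<And>x. x \<in> S \<Longrightarrow> g x = f x"
  shows "polynomial_deg_le_on I D (\<lambda>m i. real (m i)) S g"
proof -
  let ?E = "{a \<in> I \<rightarrow>\<^sub>E {..D}. (\<Sum>i\<in>I. a i) \<le> D}"
  have fin: "finite ?E" using assms(2) by (simp add: finite_PiE)
  have "\<exists>c. \<forall>m. f m = (\<Sum>a\<in>?E. c a * (\<Prod>i\<in>I. real (m i) ^ a i))"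
    using assms(1)
  proof induction
    case zero
    then show ?case by (intro exI[of _ "\<lambda>_. 0"]) simp
  next
    case (add_monomial f a c0)
    then obtain c where c: "\<And>m. f m = (\<Sum>a\<in>?E. c a * (\<Prod>i\<in>I. real (m i) ^ a i))" by blast
    \<comment> \<open>The index set of the target sum wants exponents that are
      \<open>undefined\<close> off \<open>I\<close>; restricting \<open>a\<close> changes no factor
      of the product.\<close>
    let ?a = "restrict a I"
    have le: "a i \<le> D" if "i \<in> I" for i
      using member_le_sum[of i I a] that assms(2) add_monomial.hyps by simp
    have aE: "?a \<in> ?E" using add_monomial.hyps le by (auto simp: PiE_def)
    have "f m + c0 * (\<Prod>i\<in>I. real (m i) ^ a i) =
        (\<Sum>b\<in>?E. (c b + (if b = ?a then c0 else 0)) * (\<Prod>i\<in>I. real (m i) ^ b i))" for m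
    proof -
      have "(\<Sum>b\<in>?E. (if b = ?a then c0 else 0) * (\<Prod>i\<in>I. real (m i) ^ b i)) =
          (\<Sum>b\<in>?E. (if b = ?a then c0 * (\<Prod>i\<in>I. real (m i) ^ ?a i) else 0))"
        by (intro sum.cong) auto
      also have "\<dots> = c0 * (\<Prod>i\<in>I. real (m i) ^ ?a i)"
        using aE fin by (simp only: sum.delta' sum.delta) simp
      also have "\<dots> = c0 * (\<Prod>i\<in>I. real (m i) ^ a i)" by simp
      finally show ?thesis unfolding c by (simp add: distrib_right sum.distrib)
    qed
    then show ?case by (intro exI[of _ "\<lambda>b. c b + (if b = ?a then c0 else 0)"]) simp
  qed
  then show ?thesis unfolding polynomial_deg_le_on_def using assms(3) by auto
qed

text \<open>The degree bound is strict, so that \<open>e = 0\<close> means that \<open>f\<close> vanishes.\<close>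

definition polynomial_below :: "'i set \<Rightarrow> nat \<Rightarrow> (('i \<Rightarrow> nat) \<Rightarrow> real) \<Rightarrow> bool" where
  "polynomial_below I e f \<longleftrightarrow>
     (\<exists>p. monomial_sum I e p \<and> (\<forall>m. (\<forall>i\<in>I. m i > 0) \<longrightarrow> f m = p m))"

lemma polynomial_below_zero:
  "(\<And>m. (\<forall>i\<in>I. m i > 0) \<Longrightarrow> f m = 0) \<Longrightarrow> polynomial_below I e f"
  unfolding polynomial_below_def by (auto intro!: exI[of _ "\<lambda>_. 0"] monomial_sum.zero)

lemma polynomial_below_cong:
  assumes "polynomial_below I e f" "\<And>m. (\<forall>i\<in>I. m i > 0) \<Longrightarrow> g m = f m"
  shows "polynomial_below I e g"
  using assms unfolding polynomial_below_def by auto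

lemma polynomial_below_add:
  assumes "polynomial_below I e f" "polynomial_below I e g"
  shows "polynomial_below I e (\<lambda>m. f m + g m)"
proof -
  from assms obtain p q where "monomial_sum I e p" "monomial_sum I e q"
    "\<And>m. (\<forall>i\<in>I. m i > 0) \<Longrightarrow> f m = p m" "\<And>m. (\<forall>i\<in>I. m i > 0) \<Longrightarrow> g m = q m"
    unfolding polynomial_below_def by blast
  then show ?thesis unfolding polynomial_below_def
    by (intro exI[of _ "\<lambda>m. p m + q m"]) (simp add: monomial_sum_add)
qed

lemma polynomial_below_scale:
  assumes "polynomial_below I e f"
  shows "polynomial_below I e (\<lambda>m. b * f m)"
proof -
  from assms obtain p where "monomial_sum I e p" "\<And>m. (\<forall>i\<in>I. m i > 0) \<Longrightarrow> f m = p m"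
    unfolding polynomial_below_def by blast
  then show ?thesis unfolding polynomial_below_def
    by (intro exI[of _ "\<lambda>m. b * p m"]) (simp add: monomial_sum_scale)
qed

lemma polynomial_below_diff:
  assumes "polynomial_below I e f" "polynomial_below I e g"
  shows "polynomial_below I e (\<lambda>m. f m - g m)"
  using polynomial_below_add[OF assms(1) polynomial_below_scale[OF assms(2), of "-1"]] by simp

lemma polynomial_below_const:
  "e > 0 \<Longrightarrow> polynomial_below I e (\<lambda>_. c)"
  unfolding polynomial_below_def
  using monomial_sum_monomial[of "\<lambda>_. 0" I e c] by (auto intro!: exI[of _ "\<lambda>_. c"])

lemma polynomial_below_sum:
  assumes "finite T" "\<And>t. t \<in> T \<Longrightarrow> polynomial_below I e (f t)"
  shows "polynomial_below I e (\<lambda>m. \<Sum>t\<in>T. f t m)"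
  using assms by (induction T) (auto intro: polynomial_below_zero polynomial_below_add)

lemma polynomial_below_mono:
  assumes "polynomial_below I e f" "e \<le> e'"
  shows "polynomial_below I e' f"
  using assms unfolding polynomial_below_def by (blast intro: monomial_sum_mono)

text \<open>Integrate the differences along a path that releases one coordinate after another. Each
  leg costs one degree, but the legs are added, so the total cost is one degree.\<close>

lemma polynomial_below_of_differences:
  fixes f :: "('i \<Rightarrow> nat) \<Rightarrow> real"
  assumes "finite I"
    and local: "\<And>m m'. (\<And>i. i \<in> I \<Longrightarrow> m i = m' i) \<Longrightarrow> f m = f m'"
    and diff: "\<And>j. j \<in> I \<Longrightarrow> polynomial_below I e (\<lambda>m. f (m(j := Suc (m j))) - f m)"
  shows "polynomial_below I (Suc e) f"
proof -
  \<comment> \<open>Coordinates outside \<open>J\<close> rest at 1, not 0, because the differences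
    are known at positive arguments only.\<close>
  let ?r = "\<lambda>J m i. if i \<in> J then m i else (1::nat)"
  have "polynomial_below I (Suc e) (\<lambda>m. f (?r J m))" if "J \<subseteq> I" for J
    using finite_subset[OF that assms(1)] that
  proof (induction J rule: finite_induct)
    case empty
    show ?case by (simp add: polynomial_below_const)
  next
    case (insert j J)
    then have j: "j \<in> I" by simp
    from diff[OF j] obtain p where p: "monomial_sum I e p"
      "\<And>m. (\<forall>i\<in>I. m i > 0) \<Longrightarrow> f (m(j := Suc (m j))) - f m = p m"
      unfolding polynomial_below_def by blast
    from monomial_sum_indefinite_sum[OF monomial_sum_freeze[OF p(1) assms(1), of "insert j J"] assms(1) j]
    obtain g where g: "monomial_sum I (Suc e) g"
      "\<And>m. m j \<ge> 1 \<Longrightarrow> (\<Sum>t=1..<m j. p (?r (insert j J) (m(j := t)))) = g m" by blast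
    have "f (?r (insert j J) m) = f (?r J m) + g m" if m: "\<forall>i\<in>I. m i > 0" for m
    proof -
      let ?F = "\<lambda>t. f (?r (insert j J) (m(j := t)))"
      have "(\<Sum>t=1..<m j. p (?r (insert j J) (m(j := t)))) = (\<Sum>t=1..<m j. ?F (Suc t) - ?F t)"
      proof (rule sum.cong)
        fix t assume t: "t \<in> {1..<m j}"
        have "(?r (insert j J) (m(j := t)))(j := Suc (?r (insert j J) (m(j := t)) j)) =
            ?r (insert j J) (m(j := Suc t))" by auto
        moreover have "\<forall>i\<in>I. ?r (insert j J) (m(j := t)) i > 0" using t m by auto
        ultimately show "p (?r (insert j J) (m(j := t))) = ?F (Suc t) - ?F t"
          using p(2)[of "?r (insert j J) (m(j := t))"] by simp
      qed simp
      also have "\<dots> = ?F (m j) - ?F 1"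
        using m j by (subst sum_Suc_diff') auto
      also have "?F 1 = f (?r J m)"
        using insert.hyps by (intro arg_cong[of _ _ f]) auto
      also have "?F (m j) = f (?r (insert j J) m)" by (simp only: fun_upd_triv)
      finally show ?thesis using g(2)[of m] m j by (simp add: Suc_le_eq)
    qed
    moreover have "polynomial_below I (Suc e) g"
      using g(1) unfolding polynomial_below_def by blast
    ultimately have "polynomial_below I (Suc e) (\<lambda>m. f (?r J m) + g m)"
      using insert.IH insert.prems by (intro polynomial_below_add) simp_all
    then show ?case by (rule polynomial_below_cong) fact
  qed
  then show ?thesis
    by (rule polynomial_below_cong[where f = "\<lambda>m. f (?r I m)"]) (rule subset_refl, rule local, simp)
qed

section \<open>Finite differences on the lattice\<close>

lemma int_lattice_add: "x \<in> int_lattice \<Longrightarrow> y \<in> int_lattice \<Longrightarrow> x + y \<in> int_lattice"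
  by (simp add: int_lattice_def)

lemma int_lattice_zero: "0 \<in> int_lattice"
  by (simp add: int_lattice_def)

lemma int_lattice_sum:
  "(\<And>i. i \<in> I \<Longrightarrow> f i \<in> int_lattice) \<Longrightarrow> (\<Sum>i\<in>I. f i) \<in> int_lattice"
  by (induction I rule: infinite_finite_induct) (auto simp: int_lattice_zero int_lattice_add)

lemma int_lattice_scale: "x \<in> int_lattice \<Longrightarrow> c \<in> \<int> \<Longrightarrow> c *\<^sub>R x \<in> int_lattice"
  by (simp add: int_lattice_def)

text \<open>Frechet's condition for being a polynomial of degree below \<open>K\<close> on the
  lattice. Differences along arbitrary lattice vectors are what the cell recursion produces, and no
  coefficients need to be tracked.\<close>

primrec vanishing_differences :: "nat \<Rightarrow> (real ^ 'd \<Rightarrow> real) \<Rightarrow> bool" where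
  "vanishing_differences 0 f = (\<forall>x\<in>int_lattice. f x = 0)"
| "vanishing_differences (Suc K) f =
     (\<forall>v\<in>int_lattice. vanishing_differences K (\<lambda>x. f (x + v) - f x))"

lemma vanishing_differences_cong:
  assumes "vanishing_differences K f" "\<And>x. x \<in> int_lattice \<Longrightarrow> g x = f x"
  shows "vanishing_differences K g"
  using assms
proof (induction K arbitrary: f g)
  case (Suc K)
  show ?case unfolding vanishing_differences.simps
  proof
    fix v :: "(real, 'a) vec" assume v: "v \<in> int_lattice"
    show "vanishing_differences K (\<lambda>x. g (x + v) - g x)"
      by (rule Suc.IH[of "\<lambda>x. f (x + v) - f x"]) (use Suc.prems v in \<open>auto simp: int_lattice_add\<close>)
  qed
qed auto

lemma vanishing_differences_zero:
  "(\<And>x. x \<in> int_lattice \<Longrightarrow> f x = 0) \<Longrightarrow> vanishing_differences K f"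
  by (induction K arbitrary: f) (auto simp: int_lattice_add)

lemma vanishing_differences_add:
  assumes "vanishing_differences K f" "vanishing_differences K g"
  shows "vanishing_differences K (\<lambda>x. f x + g x)"
  using assms
proof (induction K arbitrary: f g)
  case (Suc K)
  have "(\<lambda>x. f (x + v) + g (x + v) - (f x + g x)) = (\<lambda>x. (f (x + v) - f x) + (g (x + v) - g x))" for v
    by auto
  then show ?case using Suc by simp
qed auto

lemma vanishing_differences_scale:
  assumes "vanishing_differences K f"
  shows "vanishing_differences K (\<lambda>x. c * f x)"
  using assms
proof (induction K arbitrary: f)
  case (Suc K)
  then show ?case by (simp add: right_diff_distrib[symmetric])
qed auto

lemma vanishing_differences_diff:
  assumes "vanishing_differences K f" "vanishing_differences K g"
  shows "vanishing_differences K (\<lambda>x. f x - g x)"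
  using vanishing_differences_add[OF assms(1) vanishing_differences_scale[OF assms(2), of "-1"]] by simp

lemma vanishing_differences_sum:
  assumes "\<And>t. t \<in> T \<Longrightarrow> vanishing_differences K (f t)"
  shows "vanishing_differences K (\<lambda>x. \<Sum>t\<in>T. f t x)"
  using assms
  by (induction T rule: infinite_finite_induct)
    (auto intro: vanishing_differences_zero vanishing_differences_add)

lemma vanishing_differences_shift:
  assumes "vanishing_differences K f" "w \<in> int_lattice"
  shows "vanishing_differences K (\<lambda>x. f (x + w))"
  using assms
proof (induction K arbitrary: f)
  case (Suc K)
  show ?case unfolding vanishing_differences.simps
  proof
    fix v :: "(real, 'a) vec" assume v: "v \<in> int_lattice"
    have "vanishing_differences K (\<lambda>x. (\<lambda>y. f (y + v) - f y) (x + w))"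
      using Suc.prems v by (intro Suc.IH) simp_all
    then show "vanishing_differences K (\<lambda>x. f (x + v + w) - f (x + w))" by (simp add: add_ac)
  qed
qed (auto simp: int_lattice_add)

lemma vanishing_differences_Suc:
  "vanishing_differences K f \<Longrightarrow> vanishing_differences (Suc K) f"
proof (induction K arbitrary: f)
  case (Suc K)
  then have "vanishing_differences (Suc K) (\<lambda>x. f (x + v) - f x)" if "v \<in> int_lattice" for v
    using that by (intro Suc.IH) simp
  then show ?case unfolding vanishing_differences.simps(2)[of "Suc K"] by blast
qed (simp add: int_lattice_add)

lemma vanishing_differences_mono:
  "vanishing_differences K f \<Longrightarrow> K \<le> K' \<Longrightarrow> vanishing_differences K' f"
proof (induction K')
  case (Suc K')
  then show ?case using vanishing_differences_Suc[of K' f] by (cases "K = Suc K'") auto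
qed simp

text \<open>Discrete Leibniz rule. Orders \<open>a\<close> and \<open>b\<close> stand for degrees
  \<open>a - 1\<close> and \<open>b - 1\<close>, hence the order \<open>a + b - 1\<close>; if one
  order is 0 the product vanishes and truncated subtraction does no harm.\<close>

lemma vanishing_differences_mult:
  assumes "vanishing_differences a f" "vanishing_differences b g"
  shows "vanishing_differences (a + b - 1) (\<lambda>x. f x * g x)"
  using assms
proof (induction "a + b" arbitrary: a b f g)
  case 0
  then show ?case by simp
next
  case (Suc n)
  show ?case
  proof (cases "a = 0 \<or> b = 0")
    case True
    with Suc.prems show ?thesis by (intro vanishing_differences_zero) auto
  next
    case False
    then obtain a' b' where ab: "a = Suc a'" "b = Suc b'" by (meson not0_implies_Suc)
    have "vanishing_differences (a' + b') (\<lambda>x. f (x + v) * g (x + v) - f x * g x)"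
      if v: "v \<in> int_lattice" for v
    proof -
      have "vanishing_differences (a' + b - 1) (\<lambda>x. (f (x + v) - f x) * g (x + v))"
        using Suc.prems Suc.hyps(2) ab v by (intro Suc.hyps(1) vanishing_differences_shift) auto
      moreover have "vanishing_differences (a + b' - 1) (\<lambda>x. f x * (g (x + v) - g x))"
        using Suc.prems Suc.hyps(2) ab v by (intro Suc.hyps(1)) auto
      ultimately have "vanishing_differences (a' + b')
          (\<lambda>x. (f (x + v) - f x) * g (x + v) + f x * (g (x + v) - g x))"
        using ab by (intro vanishing_differences_add) auto
      then show ?thesis by (simp add: algebra_simps)
    qed
    then show ?thesis using ab by simp
  qed
qed

lemma vanishing_differences_monomial:
  fixes a :: "'d::finite \<Rightarrow> nat"
  assumes "finite I"
  shows "vanishing_differences (Suc (\<Sum>i\<in>I. a i)) (\<lambda>x :: real ^ 'd. \<Prod>i\<in>I. x $ i ^ a i)"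
  using assms
proof (induction I)
  case empty
  show ?case by simp
next
  case (insert j I)
  have "vanishing_differences (Suc r) (\<lambda>x :: real ^ 'd. x $ j ^ r)" for r
  proof (induction r)
    case (Suc r)
    have "vanishing_differences 2 (\<lambda>x :: real ^ 'd. x $ j)" by (simp add: numeral_2_eq_2)
    from vanishing_differences_mult[OF this Suc] show ?case by simp
  qed simp
  from vanishing_differences_mult[OF this insert.IH] insert.hyps show ?case by simp
qed

lemma polynomial_vanishing_differences:
  assumes "polynomial_deg_le_on UNIV k ($) int_lattice f"
  shows "vanishing_differences (Suc k) f"
proof -
  let ?E = "{a :: 'a \<Rightarrow> nat. a \<in> UNIV \<rightarrow>\<^sub>E {..k} \<and> (\<Sum>i\<in>UNIV. a i) \<le> k}"
  from assms obtain c where c: "\<And>x. x \<in> int_lattice \<Longrightarrow>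
      f x = (\<Sum>a\<in>?E. c a * (\<Prod>i\<in>UNIV. x $ i ^ a i))"
    unfolding polynomial_deg_le_on_def by blast
  have "vanishing_differences (Suc k) (\<lambda>x. \<Sum>a\<in>?E. c a * (\<Prod>i\<in>UNIV. x $ i ^ a i))"
    by (intro vanishing_differences_sum vanishing_differences_scale
        vanishing_differences_mono[OF vanishing_differences_monomial]) auto
  then show ?thesis by (rule vanishing_differences_cong) (simp add: c)
qed

text \<open>With \<open>T\<^sub>j\<close> the shift of \<open>m\<^sub>j\<close>, \<open>X\<^sub>i\<close> the shift of \<open>x\<close> by \<open>v i\<close>, the hypotheses say that
  \<open>G B\<close> is the product of the operators \<open>T\<^sub>j - X\<^sub>i\<close> over \<open>i \<in> B\<close>, applied to \<open>G {}\<close>. In the relation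
  \<open>T\<^sub>j - 1 = (X\<^sub>i - 1) + (T\<^sub>j - X\<^sub>i)\<close> both terms on the right lower the degree bound by one.\<close>

lemma polynomial_below_shift_recursion:
  fixes G :: "'i set \<Rightarrow> ('j \<Rightarrow> nat) \<Rightarrow> real ^ 'd \<Rightarrow> real"
  assumes fin: "finite \<tau>" "finite J" "cl ` \<tau> \<subseteq> J"
    and v: "\<And>i. i \<in> \<tau> \<Longrightarrow> v i \<in> int_lattice"
    and local: "\<And>B m m' x. (\<And>j. j \<in> J \<Longrightarrow> m j = m' j) \<Longrightarrow> G B m x = G B m' x"
    and rec: "\<And>B i m x. B \<subseteq> \<tau> \<Longrightarrow> i \<in> \<tau> - B \<Longrightarrow> \<forall>j\<in>J. m j > 0 \<Longrightarrow> x \<in> int_lattice \<Longrightarrow>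
      G B (m(cl i := Suc (m (cl i)))) x = G B m (x + v i) + G (insert i B) m x"
    and full: "\<And>B j m x. B \<subseteq> \<tau> \<Longrightarrow> j \<in> J \<Longrightarrow> {i \<in> \<tau>. cl i = j} \<subseteq> B \<Longrightarrow> \<forall>j\<in>J. m j > 0 \<Longrightarrow>
      x \<in> int_lattice \<Longrightarrow> G B m x = 0"
    and K: "\<And>B m. B \<subseteq> \<tau> \<Longrightarrow> \<forall>j\<in>J. m j > 0 \<Longrightarrow> vanishing_differences K (G B m)"
    and Bx: "B \<subseteq> \<tau>" "x \<in> int_lattice"
  shows "polynomial_below J (K + card (\<tau> - B) - card J) (\<lambda>m. G B m x)"
  using local rec full K Bx
proof (induction "K + card (\<tau> - B)" arbitrary: K B G x rule: less_induct)
  case less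
  note local = less.prems(1) and rec = less.prems(2) and full = less.prems(3) and K = less.prems(4)
    and B = less.prems(5) and x = less.prems(6)
  show ?case
  proof (cases "K = 0 \<or> (\<exists>j\<in>J. {i \<in> \<tau>. cl i = j} \<subseteq> B)")
    case True
    then show ?thesis
    proof
      assume "K = 0"
      then have "G B m x = 0" if "\<forall>j\<in>J. m j > 0" for m using K[OF B that] x by simp
      then show ?thesis by (rule polynomial_below_zero)
    next
      assume "\<exists>j\<in>J. {i \<in> \<tau>. cl i = j} \<subseteq> B"
      then show ?thesis using full[OF B _ _ _ x] by (auto intro: polynomial_below_zero)
    qed
  next
    case False
    then obtain K' where K': "K = Suc K'" using not0_implies_Suc by blast
    \<comment> \<open>Every label still owns a generator outside \<open>B\<close>. One choice per
      label yields \<open>card J \<le> card (\<tau> - B)\<close>, which makes the natural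
      subtraction in the degree bound exact.\<close>
    have "\<forall>j\<in>J. \<exists>i. i \<in> \<tau> - B \<and> cl i = j" using False by blast
    then obtain s where s: "\<And>j. j \<in> J \<Longrightarrow> s j \<in> \<tau> - B \<and> cl (s j) = j" by metis
    have "inj_on s J" using s by (metis inj_onI)
    then have card: "card J \<le> card (\<tau> - B)"
      using s fin by (intro card_inj_on_le[of s]) auto
    have "polynomial_below J (K' + card (\<tau> - B) - card J) (\<lambda>m. G B (m(j := Suc (m j))) x - G B m x)"
      if j: "j \<in> J" for j
    proof -
      define i where "i = s j"
      have i: "i \<in> \<tau>" "i \<notin> B" "cl i = j" using s[OF j] by (auto simp: i_def)
      have c: "card (\<tau> - B) = Suc (card (\<tau> - insert i B))"
      proof -
        have "\<tau> - B = insert i (\<tau> - insert i B)" using i by auto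
        then show ?thesis using fin by (metis DiffD2 card_insert_disjoint finite_Diff insertI1)
      qed
      \<comment> \<open>The induction hypothesis is applied to the differences
        \<open>G B m (x + v i) - G B m x\<close> for all \<open>B\<close> at once: this family
        inherits the recursion and loses one order in \<open>K\<close>.\<close>
      have "polynomial_below J (K' + card (\<tau> - B) - card J) (\<lambda>m. G B m (x + v i) - G B m x)"
      proof (rule less.hyps[where G = "\<lambda>B m x. G B m (x + v i) - G B m x"])
        show "K' + card (\<tau> - B) < K + card (\<tau> - B)" using K' by simp
        show "G B m (x + v i) - G B m x = G B m' (x + v i) - G B m' x"
          if "\<And>j. j \<in> J \<Longrightarrow> m j = m' j" for B m m' x
          using local[of m m' B, OF that] by simp
        show "G B (m(cl i' := Suc (m (cl i')))) (x + v i) - G B (m(cl i' := Suc (m (cl i')))) x =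
            G B m (x + v i' + v i) - G B m (x + v i') +
            (G (insert i' B) m (x + v i) - G (insert i' B) m x)"
          if "B \<subseteq> \<tau>" "i' \<in> \<tau> - B" "\<forall>j\<in>J. m j > 0" "x \<in> int_lattice" for B i' m x
          using rec[OF that] rec[OF that(1-3), of "x + v i"] that v[OF i(1)]
          by (simp add: int_lattice_add add_ac)
        show "G B m (x + v i) - G B m x = 0"
          if "B \<subseteq> \<tau>" "j \<in> J" "{i \<in> \<tau>. cl i = j} \<subseteq> B" "\<forall>j\<in>J. m j > 0" "x \<in> int_lattice" for B j m x
          using full[OF that] full[OF that(1-4), of "x + v i"] that v[OF i(1)]
          by (simp add: int_lattice_add)
        show "vanishing_differences K' (\<lambda>x. G B m (x + v i) - G B m x)"
          if "B \<subseteq> \<tau>" "\<forall>j\<in>J. m j > 0" for B m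
          using K[OF that] v[OF i(1)] K' by simp
      qed (use B x in auto)
      \<comment> \<open>Here \<open>K\<close> stays and one generator leaves
        \<open>\<tau> - B\<close>, which gives the same bound.\<close>
      moreover have "polynomial_below J (K + card (\<tau> - insert i B) - card J) (\<lambda>m. G (insert i B) m x)"
        by (rule less.hyps[OF _ local rec full K _ x]) (use i c B in auto)
      moreover have "K + card (\<tau> - insert i B) - card J = K' + card (\<tau> - B) - card J"
        using c K' by simp
      ultimately have "polynomial_below J (K' + card (\<tau> - B) - card J)
          (\<lambda>m. (G B m (x + v i) - G B m x) + G (insert i B) m x)"
        by (intro polynomial_below_add) simp_all
      then show ?thesis
        by (rule polynomial_below_cong) (use rec[OF B, of i] i x in auto)
    qed
    note diff = this
    have "polynomial_below J (Suc (K' + card (\<tau> - B) - card J)) (\<lambda>m. G B m x)"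
      by (rule polynomial_below_of_differences[OF fin(2) local diff])
    then show ?thesis using K' card by (simp add: Suc_diff_le)
  qed
qed

section \<open>Valuations of Minkowski sums of polytopes\<close>

lemma ring_of_sets_integer_polytope_ring: "ring_of_sets UNIV integer_polytope_ring"
  unfolding integer_polytope_ring_def ring_of_sets_iff by blast

lemma
  shows integer_polytope_ring_empty: "{} \<in> integer_polytope_ring"
    and integer_polytope_ring_Un: "S \<in> integer_polytope_ring \<Longrightarrow> T \<in> integer_polytope_ring \<Longrightarrow>
      S \<union> T \<in> integer_polytope_ring"
    and integer_polytope_ring_Diff: "S \<in> integer_polytope_ring \<Longrightarrow> T \<in> integer_polytope_ring \<Longrightarrow>
      S - T \<in> integer_polytope_ring"
  using ring_of_sets_integer_polytope_ring unfolding ring_of_sets_iff by blast+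

lemma integer_polytope_in_ring: "convex_integer_polytope P \<Longrightarrow> P \<in> integer_polytope_ring"
  unfolding integer_polytope_ring_def by blast

lemma valuation_Un:
  assumes "integer_polytope_valuation \<mu>" "S \<in> integer_polytope_ring" "T \<in> integer_polytope_ring"
    "S \<inter> T = {}"
  shows "\<mu> (S \<union> T) = \<mu> S + \<mu> T"
  using assms unfolding integer_polytope_valuation_def additive_def by blast

lemma valuation_empty:
  assumes "integer_polytope_valuation \<mu>"
  shows "\<mu> {} = 0"
  using valuation_Un[OF assms integer_polytope_ring_empty integer_polytope_ring_empty] by simp

lemma valuation_Diff:
  assumes "integer_polytope_valuation \<mu>" "S \<in> integer_polytope_ring" "T \<in> integer_polytope_ring"
    "T \<subseteq> S"
  shows "\<mu> (S - T) = \<mu> S - \<mu> T"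
proof -
  have "\<mu> (T \<union> (S - T)) = \<mu> T + \<mu> (S - T)"
    using assms by (intro valuation_Un integer_polytope_ring_Diff) auto
  moreover have "T \<union> (S - T) = S" using assms by blast
  ultimately show ?thesis by simp
qed

lemma valuation_UN:
  assumes "integer_polytope_valuation \<mu>" "finite I" "\<And>i. i \<in> I \<Longrightarrow> F i \<in> integer_polytope_ring"
    "\<And>i j. i \<in> I \<Longrightarrow> j \<in> I \<Longrightarrow> i \<noteq> j \<Longrightarrow> F i \<inter> F j = {}"
  shows "(\<Union>i\<in>I. F i) \<in> integer_polytope_ring \<and> \<mu> (\<Union>i\<in>I. F i) = (\<Sum>i\<in>I. \<mu> (F i))"
  using assms(2-)
proof (induction I)
  case empty
  then show ?case using assms(1) by (simp add: valuation_empty integer_polytope_ring_empty)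
next
  case (insert i I)
  then have IH: "(\<Union>i\<in>I. F i) \<in> integer_polytope_ring" "\<mu> (\<Union>i\<in>I. F i) = (\<Sum>i\<in>I. \<mu> (F i))"
    by simp_all
  have "F i \<inter> (\<Union>i\<in>I. F i) = {}" using insert.hyps insert.prems(2)[of i] by blast
  with IH insert show ?case
    using valuation_Un[OF assms(1), of "F i" "\<Union>i\<in>I. F i"]
    by (simp add: integer_polytope_ring_Un)
qed

lemma convex_integer_polytope_hull:
  assumes "finite W" "W \<subseteq> int_lattice"
  shows "convex_integer_polytope (convex hull W)"
  using assms extreme_point_of_convex_hull unfolding convex_integer_polytope_def polytope_def by blast

lemma convex_integer_polytope_obtain:
  assumes "convex_integer_polytope P"
  obtains W where "finite W" "W \<subseteq> int_lattice" "P = convex hull W"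
proof -
  from assms have P: "polytope P" "{v. v extreme_point_of P} \<subseteq> int_lattice"
    unfolding convex_integer_polytope_def by auto
  have "finite {v. v extreme_point_of P}"
    using P(1) by (simp add: finite_polyhedron_extreme_points polytope_imp_polyhedron)
  moreover have "P = convex hull {v. v extreme_point_of P}"
    using P(1) by (simp add: Krein_Milman_Minkowski polytope_imp_compact polytope_imp_convex)
  ultimately show thesis using that P(2) by blast
qed

lemma convex_integer_polytope_translate:
  assumes "convex_integer_polytope P" "v \<in> int_lattice"
  shows "convex_integer_polytope ((\<lambda>p. p + v) ` P)"
proof -
  from assms(1) obtain W where W: "finite W" "W \<subseteq> int_lattice" "P = convex hull W"
    by (rule convex_integer_polytope_obtain)
  have "(\<lambda>p. p + v) ` P = convex hull ((\<lambda>p. p + v) ` W)"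
    using convex_hull_translation[of v W] W(3) by (simp add: add.commute)
  then show ?thesis using W assms(2) by (auto intro!: convex_integer_polytope_hull int_lattice_add)
qed

text \<open>Convex hulls commute with scaling and with Minkowski sums, so the result is the hull of
  finitely many sums of scaled lattice points.\<close>

lemma convex_integer_polytope_minkowski_sum:
  fixes P :: "'j \<Rightarrow> (real ^ 'd) set"
  assumes "finite J" "\<And>j. j \<in> J \<Longrightarrow> convex_integer_polytope (P j)"
  shows "convex_integer_polytope (\<Sum>j\<in>J. (\<lambda>x. real (m j) *\<^sub>R x) ` P j)"
proof -
  from assms(2) have "\<forall>j\<in>J. \<exists>W. finite W \<and> W \<subseteq> int_lattice \<and> P j = convex hull W"
    using convex_integer_polytope_obtain by metis
  then obtain W where W: "\<And>j. j \<in> J \<Longrightarrow> finite (W j) \<and> W j \<subseteq> int_lattice \<and> P j = convex hull W j"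
    by metis
  let ?V = "\<Sum>j\<in>J. (\<lambda>x. real (m j) *\<^sub>R x) ` W j"
  have "(\<Sum>j\<in>J. (\<lambda>x. real (m j) *\<^sub>R x) ` P j) = (\<Sum>j\<in>J. convex hull ((\<lambda>x. real (m j) *\<^sub>R x) ` W j))"
    using W by (intro sum.cong refl) (simp add: convex_hull_scaling)
  also have "\<dots> = convex hull ?V" by (rule convex_hull_set_sum[symmetric])
  finally have *: "(\<Sum>j\<in>J. (\<lambda>x. real (m j) *\<^sub>R x) ` P j) = convex hull ?V" .
  have "finite (\<Sum>j\<in>I. (\<lambda>x. real (m j) *\<^sub>R x) ` W j)" if "I \<subseteq> J" for I
    using finite_subset[OF that assms(1)] that W by (induction I rule: finite_induct) (auto intro!: finite_set_plus)
  then have "finite ?V" by blast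
  moreover have "?V \<subseteq> int_lattice"
  proof
    fix x assume "x \<in> ?V"
    then obtain s where s: "x = sum s J" "\<And>j. j \<in> J \<Longrightarrow> s j \<in> (\<lambda>x. real (m j) *\<^sub>R x) ` W j"
      unfolding set_sum_alt[OF assms(1)] by blast
    have "s j \<in> int_lattice" if "j \<in> J" for j
      using s(2)[OF that] W[OF that] by (auto intro!: int_lattice_scale)
    then show "x \<in> int_lattice" unfolding s(1) by (rule int_lattice_sum)
  qed
  ultimately show ?thesis unfolding * by (rule convex_integer_polytope_hull)
qed

section \<open>Cells of the Cayley configuration\<close>

text \<open>A generator \<open>p = (j, w)\<close> of the Cayley configuration is a point \<open>w\<close> labelled by the index \<open>j\<close>
  of the polytope it belongs to; the slice of the Cayley cone at height \<open>m\<close> is the Minkowski sum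
  of the \<open>m j\<close>-fold multiples.\<close>

definition point_sum :: "('j \<times> (real ^ 'd)) set \<Rightarrow> ('j \<times> (real ^ 'd) \<Rightarrow> real) \<Rightarrow> real ^ 'd" where
  "point_sum \<tau> \<alpha> = (\<Sum>p\<in>\<tau>. \<alpha> p *\<^sub>R snd p)"

definition label_sum :: "('j \<times> (real ^ 'd)) set \<Rightarrow> ('j \<times> (real ^ 'd) \<Rightarrow> real) \<Rightarrow> 'j \<Rightarrow> real" where
  "label_sum \<tau> \<alpha> j = (\<Sum>p | p \<in> \<tau> \<and> fst p = j. \<alpha> p)"

definition closed_cell :: "'j set \<Rightarrow> ('j \<times> (real ^ 'd)) set \<Rightarrow> ('j \<Rightarrow> nat) \<Rightarrow> (real ^ 'd) set" where
  "closed_cell J \<tau> m = {point_sum \<tau> \<alpha> | \<alpha>. (\<forall>p\<in>\<tau>. 0 \<le> \<alpha> p) \<and> (\<forall>j\<in>J. label_sum \<tau> \<alpha> j = real (m j))}"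

text \<open>\<open>B\<close> marks the generators whose coefficient is capped at 1. The cells with
  \<open>B = {}\<close> are the open faces; the others are what remains after translates have been
  split off.\<close>

definition open_cell ::
  "'j set \<Rightarrow> ('j \<times> (real ^ 'd)) set \<Rightarrow> ('j \<times> (real ^ 'd)) set \<Rightarrow> ('j \<Rightarrow> nat) \<Rightarrow> (real ^ 'd) set" where
  "open_cell J \<tau> B m = {point_sum \<tau> \<alpha> | \<alpha>. (\<forall>p\<in>\<tau>. 0 < \<alpha> p) \<and> (\<forall>p\<in>B. \<alpha> p \<le> 1) \<and>
     (\<forall>j\<in>J. label_sum \<tau> \<alpha> j = real (m j))}"

text \<open>Linear independence of the lifted vectors \<open>(e_j, w)\<close>, with
  \<open>e_j\<close> the unit vector of the label \<open>j\<close>, written blockwise so that the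
  lifted space needs no type.\<close>

definition cayley_independent :: "'j set \<Rightarrow> ('j \<times> (real ^ 'd)) set \<Rightarrow> bool" where
  "cayley_independent J \<tau> \<longleftrightarrow>
     (\<forall>\<gamma>. point_sum \<tau> \<gamma> = 0 \<and> (\<forall>j\<in>J. label_sum \<tau> \<gamma> j = 0) \<longrightarrow> (\<forall>p\<in>\<tau>. \<gamma> p = 0))"

lemma point_sum_linear:
  "point_sum \<tau> (\<lambda>p. \<alpha> p + \<beta> p) = point_sum \<tau> \<alpha> + point_sum \<tau> \<beta>"
  "point_sum \<tau> (\<lambda>p. \<alpha> p - \<beta> p) = point_sum \<tau> \<alpha> - point_sum \<tau> \<beta>"
  "point_sum \<tau> (\<lambda>p. - \<alpha> p) = - point_sum \<tau> \<alpha>"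
  "point_sum \<tau> (\<lambda>p. c * \<alpha> p) = c *\<^sub>R point_sum \<tau> \<alpha>"
  by (simp_all add: point_sum_def algebra_simps sum.distrib sum_subtractf sum_negf scaleR_sum_right)

lemma label_sum_linear:
  "label_sum \<tau> (\<lambda>p. \<alpha> p + \<beta> p) j = label_sum \<tau> \<alpha> j + label_sum \<tau> \<beta> j"
  "label_sum \<tau> (\<lambda>p. \<alpha> p - \<beta> p) j = label_sum \<tau> \<alpha> j - label_sum \<tau> \<beta> j"
  "label_sum \<tau> (\<lambda>p. - \<alpha> p) j = - label_sum \<tau> \<alpha> j"
  "label_sum \<tau> (\<lambda>p. c * \<alpha> p) j = c * label_sum \<tau> \<alpha> j"
  by (simp_all add: label_sum_def sum.distrib sum_subtractf sum_negf sum_distrib_left)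

lemma point_sum_delta:
  "finite \<tau> \<Longrightarrow> q \<in> \<tau> \<Longrightarrow> point_sum \<tau> (\<lambda>p. if p = q then 1 else 0) = snd q"
  unfolding point_sum_def by (subst sum.mono_neutral_right[of _ "{q}"]) auto

lemma label_sum_delta:
  "finite \<tau> \<Longrightarrow> q \<in> \<tau> \<Longrightarrow> label_sum \<tau> (\<lambda>p. if p = q then 1 else 0) j = (if fst q = j then 1 else 0)"
  unfolding label_sum_def by (subst sum.delta) auto

lemma point_sum_cong: "(\<And>p. p \<in> \<tau> \<Longrightarrow> \<alpha> p = \<beta> p) \<Longrightarrow> point_sum \<tau> \<alpha> = point_sum \<tau> \<beta>"
  by (simp add: point_sum_def)

lemma label_sum_cong: "(\<And>p. p \<in> \<tau> \<Longrightarrow> \<alpha> p = \<beta> p) \<Longrightarrow> label_sum \<tau> \<alpha> j = label_sum \<tau> \<beta> j"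
  by (simp add: label_sum_def)

lemma point_sum_mono_neutral:
  assumes "finite \<tau>" "\<sigma> \<subseteq> \<tau>" "\<And>p. p \<in> \<tau> - \<sigma> \<Longrightarrow> \<alpha> p = 0"
  shows "point_sum \<tau> \<alpha> = point_sum \<sigma> \<alpha>"
  unfolding point_sum_def using assms by (intro sum.mono_neutral_right) auto

lemma label_sum_mono_neutral:
  assumes "finite \<tau>" "\<sigma> \<subseteq> \<tau>" "\<And>p. p \<in> \<tau> - \<sigma> \<Longrightarrow> \<alpha> p = 0"
  shows "label_sum \<tau> \<alpha> j = label_sum \<sigma> \<alpha> j"
  unfolding label_sum_def using assms by (intro sum.mono_neutral_right) auto

lemma sums_zero_extend:
  fixes \<alpha> :: "'j \<times> (real ^ 'd) \<Rightarrow> real"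
  assumes "finite \<tau>" "\<sigma> \<subseteq> \<tau>"
  shows "point_sum \<tau> (\<lambda>p. if p \<in> \<sigma> then \<alpha> p else 0) = point_sum \<sigma> \<alpha>"
    "label_sum \<tau> (\<lambda>p. if p \<in> \<sigma> then \<alpha> p else 0) j = label_sum \<sigma> \<alpha> j"
  using point_sum_mono_neutral[OF assms, of "\<lambda>p. if p \<in> \<sigma> then \<alpha> p else 0"]
    label_sum_mono_neutral[OF assms, of "\<lambda>p. if p \<in> \<sigma> then \<alpha> p else 0" j]
    point_sum_cong[of \<sigma> "\<lambda>p. if p \<in> \<sigma> then \<alpha> p else 0" \<alpha>]
    label_sum_cong[of \<sigma> "\<lambda>p. if p \<in> \<sigma> then \<alpha> p else 0" \<alpha> j]
  by simp_all

lemma cayley_independent_unique: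
  assumes "cayley_independent J \<tau>" "point_sum \<tau> \<alpha> = point_sum \<tau> \<beta>"
    "\<And>j. j \<in> J \<Longrightarrow> label_sum \<tau> \<alpha> j = label_sum \<tau> \<beta> j" "p \<in> \<tau>"
  shows "\<alpha> p = \<beta> p"
proof -
  have "\<forall>p\<in>\<tau>. \<alpha> p - \<beta> p = 0"
    using assms(1)[unfolded cayley_independent_def, rule_format, of "\<lambda>p. \<alpha> p - \<beta> p"] assms(2,3)
    by (simp add: point_sum_linear label_sum_linear)
  then show ?thesis using assms(4) by simp
qed

lemma cayley_independent_subset:
  assumes "cayley_independent J \<tau>" "finite \<tau>" "\<sigma> \<subseteq> \<tau>"
  shows "cayley_independent J \<sigma>"
  unfolding cayley_independent_def
proof (intro allI impI ballI)
  fix \<gamma> p assume \<gamma>: "point_sum \<sigma> \<gamma> = 0 \<and> (\<forall>j\<in>J. label_sum \<sigma> \<gamma> j = 0)" and p: "p \<in> \<sigma>"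
  have "(if p \<in> \<sigma> then \<gamma> p else 0) = 0"
    using assms(1)[unfolded cayley_independent_def, rule_format, of "\<lambda>p. if p \<in> \<sigma> then \<gamma> p else 0" p]
      \<gamma> p assms(3) by (auto simp: sums_zero_extend[OF assms(2,3)])
  then show "\<gamma> p = 0" using p by simp
qed

text \<open>Stated for families because differences of generators may coincide; a coincidence is
  then itself the relation.\<close>

lemma exists_linear_relation:
  fixes u :: "'p \<Rightarrow> 'a::euclidean_space"
  assumes "finite T" "card T > DIM('a)"
  shows "\<exists>c. (\<exists>p\<in>T. c p \<noteq> 0) \<and> (\<Sum>p\<in>T. c p *\<^sub>R u p) = 0"
proof (cases "inj_on u T")
  case True
  then have "dependent (u ` T)"
    using assms by (intro dependent_biggerset) (simp_all add: card_image)
  then obtain w where "\<exists>v\<in>u ` T. w v \<noteq> 0" "(\<Sum>v\<in>u ` T. w v *\<^sub>R v) = 0"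
    using dependent_finite[of "u ` T"] assms(1) by blast
  then show ?thesis using True by (intro exI[of _ "w \<circ> u"]) (simp add: sum.reindex)
next
  case False
  then obtain p q where pq: "p \<in> T" "q \<in> T" "p \<noteq> q" "u p = u q" unfolding inj_on_def by blast
  have "(\<Sum>r\<in>T. (if r = p then 1 else if r = q then - 1 else 0) *\<^sub>R u r) =
      (\<Sum>r\<in>{p, q}. (if r = p then 1 else if r = q then - 1 else 0) *\<^sub>R u r)"
    using pq assms(1) by (intro sum.mono_neutral_right) auto
  also have "\<dots> = 0" using pq by simp
  finally show ?thesis
    using pq by (intro exI[of _ "\<lambda>r. if r = p then 1 else if r = q then - 1 else 0"]) auto
qed

text \<open>Fix a base generator for every label. The differences of the remaining generators to
  their bases lie in dimension \<open>CARD('d)\<close>, so too many of them would be linearly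
  related.\<close>

lemma cayley_independent_card:
  fixes \<tau> :: "('j \<times> (real ^ 'd)) set"
  assumes "cayley_independent J \<tau>" "finite \<tau>" "finite J" "fst ` \<tau> = J"
  shows "card \<tau> \<le> card J + CARD('d)"
proof (rule ccontr)
  assume less: "\<not> ?thesis"
  have "\<forall>j\<in>J. \<exists>p. p \<in> \<tau> \<and> fst p = j" using assms(4) by auto
  then obtain b where b: "\<And>j. j \<in> J \<Longrightarrow> b j \<in> \<tau> \<and> fst (b j) = j" by metis
  define T where "T = \<tau> - b ` J"
  have inj: "inj_on b J" using b by (metis inj_onI)
  have "card T = card \<tau> - card J"
    unfolding T_def using b assms(2,3)
    by (subst card_Diff_subset) (simp_all add: card_image[OF inj] image_subset_iff)
  then have "card T > DIM(real ^ 'd)" using less by simp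
  moreover have T: "finite T" using assms(2) by (simp add: T_def)
  ultimately obtain c where c: "\<exists>p\<in>T. c p \<noteq> 0" "(\<Sum>p\<in>T. c p *\<^sub>R (snd p - snd (b (fst p)))) = 0"
    using exists_linear_relation[of T "\<lambda>p. snd p - snd (b (fst p))"] by blast
  \<comment> \<open>Lifting the relation: the base of each label takes minus the sum of the other
    coefficients, so that the label sums vanish too.\<close>
  define \<gamma> where "\<gamma> p = (if p \<in> T then c p else - label_sum T c (fst p))" for p
  have "label_sum \<tau> \<gamma> j = 0" if j: "j \<in> J" for j
  proof -
    have "{p. p \<in> \<tau> \<and> fst p = j} = insert (b j) {p. p \<in> T \<and> fst p = j}"
      using b j by (auto simp: T_def)
    moreover have "b j \<notin> T" using j by (simp add: T_def)
    moreover have "fst (b j) = j" using b j by blast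
    ultimately show ?thesis using T unfolding label_sum_def[of \<tau>] by (simp add: \<gamma>_def label_sum_def)
  qed
  moreover have "point_sum \<tau> \<gamma> = 0"
  proof -
    have "point_sum \<tau> \<gamma> = (\<Sum>p\<in>b ` J. \<gamma> p *\<^sub>R snd p) + (\<Sum>p\<in>T. \<gamma> p *\<^sub>R snd p)"
      unfolding point_sum_def T_def using assms(2) b by (subst add.commute, intro sum.subset_diff) auto
    also have "(\<Sum>p\<in>T. \<gamma> p *\<^sub>R snd p) = (\<Sum>p\<in>T. c p *\<^sub>R snd p)"
      by (simp add: \<gamma>_def)
    also have "(\<Sum>p\<in>b ` J. \<gamma> p *\<^sub>R snd p) = (\<Sum>j\<in>J. - label_sum T c j *\<^sub>R snd (b j))"
      using b by (subst sum.reindex[OF inj]) (auto simp: \<gamma>_def T_def intro!: sum.cong)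
    also have "\<dots> = - (\<Sum>j\<in>J. \<Sum>p | p \<in> T \<and> fst p = j. c p *\<^sub>R snd (b (fst p)))"
      by (simp add: label_sum_def scaleR_sum_left sum_negf)
    also have "(\<Sum>j\<in>J. \<Sum>p | p \<in> T \<and> fst p = j. c p *\<^sub>R snd (b (fst p))) = (\<Sum>p\<in>T. c p *\<^sub>R snd (b (fst p)))"
      using T assms(3,4) by (intro sum.group) (auto simp: T_def)
    finally show ?thesis using c(2) by (simp add: scaleR_diff_right sum_subtractf)
  qed
  ultimately have "\<forall>p\<in>\<tau>. \<gamma> p = 0" using assms(1) unfolding cayley_independent_def by blast
  then show False using c(1) by (auto simp: \<gamma>_def T_def)
qed

text \<open>The Cayley trick: the coefficients with label \<open>j\<close> add up to
  \<open>m j\<close>, and dividing them by the positive number \<open>m j\<close> leaves a convex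
  combination.\<close>

lemma closed_cell_eq_minkowski_sum:
  fixes \<tau> :: "('j \<times> (real ^ 'd)) set"
  assumes fin: "finite \<tau>" "finite J" and J: "fst ` \<tau> \<subseteq> J" and m: "\<forall>j\<in>J. m j > 0"
  shows "closed_cell J \<tau> m = (\<Sum>j\<in>J. (\<lambda>x. real (m j) *\<^sub>R x) ` (convex hull {w. (j, w) \<in> \<tau>}))"
    (is "_ = ?M")
proof
  have group: "point_sum \<tau> \<alpha> = (\<Sum>j\<in>J. \<Sum>p | p \<in> \<tau> \<and> fst p = j. \<alpha> p *\<^sub>R snd p)" for \<alpha>
    unfolding point_sum_def using fin J by (intro sum.group[symmetric])
  show "closed_cell J \<tau> m \<subseteq> ?M"
  proof
    fix x assume "x \<in> closed_cell J \<tau> m"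
    then obtain \<alpha> where x: "x = point_sum \<tau> \<alpha>" and \<alpha>: "\<And>p. p \<in> \<tau> \<Longrightarrow> 0 \<le> \<alpha> p"
        "\<And>j. j \<in> J \<Longrightarrow> label_sum \<tau> \<alpha> j = real (m j)"
      unfolding closed_cell_def by blast
    have "(\<Sum>p | p \<in> \<tau> \<and> fst p = j. \<alpha> p *\<^sub>R snd p) \<in> (\<lambda>x. real (m j) *\<^sub>R x) ` (convex hull {w. (j, w) \<in> \<tau>})"
      if j: "j \<in> J" for j
    proof
      have mj: "real (m j) > 0" using m j by simp
      show "(\<Sum>p | p \<in> \<tau> \<and> fst p = j. \<alpha> p *\<^sub>R snd p) =
          real (m j) *\<^sub>R (\<Sum>p | p \<in> \<tau> \<and> fst p = j. (\<alpha> p / m j) *\<^sub>R snd p)"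
        using mj by (simp add: scaleR_sum_right)
      show "(\<Sum>p | p \<in> \<tau> \<and> fst p = j. (\<alpha> p / m j) *\<^sub>R snd p) \<in> convex hull {w. (j, w) \<in> \<tau>}"
      proof (rule convex_sum)
        show "(\<Sum>p | p \<in> \<tau> \<and> fst p = j. \<alpha> p / real (m j)) = 1"
          using \<alpha>(2)[OF j] mj by (simp add: label_sum_def flip: sum_divide_distrib)
        show "snd p \<in> convex hull {w. (j, w) \<in> \<tau>}" if "p \<in> {p. p \<in> \<tau> \<and> fst p = j}" for p
          using that by (intro hull_inc) auto
      qed (use fin \<alpha>(1) mj in auto)
    qed
    then show "x \<in> ?M" unfolding x group set_sum_alt[OF fin(2)] by blast
  qed
  show "?M \<subseteq> closed_cell J \<tau> m"
  proof
    fix x assume "x \<in> ?M"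
    then obtain s where x: "x = sum s J"
      and s: "\<forall>j\<in>J. s j \<in> (\<lambda>x. real (m j) *\<^sub>R x) ` (convex hull {w. (j, w) \<in> \<tau>})"
      unfolding set_sum_alt[OF fin(2)] by blast
    have "{w. (j, w) \<in> \<tau>} \<subseteq> snd ` \<tau>" for j by force
    then have finw: "finite {w. (j, w) \<in> \<tau>}" for j
      using fin(1) by (meson finite_imageI finite_subset)
    have "\<exists>u. (\<forall>w\<in>{w. (j, w) \<in> \<tau>}. 0 \<le> u w) \<and> sum u {w. (j, w) \<in> \<tau>} = 1 \<and>
        s j = real (m j) *\<^sub>R (\<Sum>w | (j, w) \<in> \<tau>. u w *\<^sub>R w)" (is "\<exists>u. ?Q j u") if j: "j \<in> J" for j
    proof -
      from s j obtain y where y: "y \<in> convex hull {w. (j, w) \<in> \<tau>}" "s j = real (m j) *\<^sub>R y" by blast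
      then obtain u where "\<forall>w\<in>{w. (j, w) \<in> \<tau>}. 0 \<le> u w" "sum u {w. (j, w) \<in> \<tau>} = 1"
          "(\<Sum>w | (j, w) \<in> \<tau>. u w *\<^sub>R w) = y"
        unfolding convex_hull_finite[OF finw] by blast
      then show ?thesis using y(2) by blast
    qed
    then have "\<exists>u. \<forall>j\<in>J. ?Q j (u j)" by (intro bchoice) blast
    then obtain u where u: "\<And>j w. j \<in> J \<Longrightarrow> (j, w) \<in> \<tau> \<Longrightarrow> 0 \<le> u j w"
        "\<And>j. j \<in> J \<Longrightarrow> sum (u j) {w. (j, w) \<in> \<tau>} = 1"
        "\<And>j. j \<in> J \<Longrightarrow> s j = real (m j) *\<^sub>R (\<Sum>w | (j, w) \<in> \<tau>. u j w *\<^sub>R w)"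
      by blast
    define \<alpha> where "\<alpha> p = real (m (fst p)) * u (fst p) (snd p)" for p
    have slice: "{p. p \<in> \<tau> \<and> fst p = j} = Pair j ` {w. (j, w) \<in> \<tau>}" for j by auto
    have inj: "inj_on (Pair j) S" for j :: 'j and S :: "(real ^ 'd) set" by (auto intro: inj_onI)
    have "point_sum \<tau> \<alpha> = (\<Sum>j\<in>J. s j)"
      unfolding group slice using u(3)
      by (intro sum.cong refl) (simp add: sum.reindex[OF inj] \<alpha>_def scaleR_sum_right)
    moreover have "label_sum \<tau> \<alpha> j = real (m j)" if "j \<in> J" for j
      unfolding label_sum_def slice using u(2)[OF that]
      by (simp add: sum.reindex[OF inj] \<alpha>_def flip: sum_distrib_left)
    moreover have "0 \<le> \<alpha> p" if "p \<in> \<tau>" for p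
      using that u(1)[of "fst p" "snd p"] J by (auto simp: \<alpha>_def)
    ultimately show "x \<in> closed_cell J \<tau> m"
      unfolding closed_cell_def x mem_Collect_eq by (intro exI[of _ \<alpha>]) simp
  qed
qed

lemma convex_integer_polytope_closed_cell:
  fixes \<tau> :: "('j \<times> (real ^ 'd)) set"
  assumes "finite \<tau>" "finite J" "fst ` \<tau> \<subseteq> J" "\<forall>j\<in>J. m j > 0" "snd ` \<tau> \<subseteq> int_lattice"
  shows "convex_integer_polytope (closed_cell J \<tau> m)"
proof -
  have "{w. (j, w) \<in> \<tau>} \<subseteq> snd ` \<tau>" for j by force
  then have "finite {w. (j, w) \<in> \<tau>}" for j
    using assms(1) by (meson finite_imageI finite_subset)
  moreover have "{w. (j, w) \<in> \<tau>} \<subseteq> int_lattice" for j using assms(5) by force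
  ultimately show ?thesis
    unfolding closed_cell_eq_minkowski_sum[OF assms(1-4)]
    by (intro convex_integer_polytope_minkowski_sum convex_integer_polytope_hull assms(2))
qed

text \<open>Sort the representations by their support.\<close>

lemma closed_cell_faces:
  fixes \<tau> :: "('j \<times> (real ^ 'd)) set"
  assumes "finite \<tau>"
  shows "closed_cell J \<tau> m = (\<Union>\<sigma>\<in>Pow \<tau>. open_cell J \<sigma> {} m)"
proof
  show "closed_cell J \<tau> m \<subseteq> (\<Union>\<sigma>\<in>Pow \<tau>. open_cell J \<sigma> {} m)"
  proof
    fix x assume "x \<in> closed_cell J \<tau> m"
    then obtain \<alpha> where x: "x = point_sum \<tau> \<alpha>" and \<alpha>: "\<forall>p\<in>\<tau>. 0 \<le> \<alpha> p"
        "\<forall>j\<in>J. label_sum \<tau> \<alpha> j = real (m j)"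
      unfolding closed_cell_def by blast
    let ?\<sigma> = "{p\<in>\<tau>. 0 < \<alpha> p}"
    have z: "\<alpha> p = 0" if "p \<in> \<tau> - ?\<sigma>" for p using that \<alpha>(1) by force
    have "x = point_sum ?\<sigma> \<alpha>" unfolding x by (rule point_sum_mono_neutral[OF assms _ z]) auto
    moreover have "label_sum \<tau> \<alpha> j = label_sum ?\<sigma> \<alpha> j" for j
      by (rule label_sum_mono_neutral[OF assms _ z]) auto
    ultimately have "x \<in> open_cell J ?\<sigma> {} m"
      using \<alpha>(2) unfolding open_cell_def mem_Collect_eq by (intro exI[of _ \<alpha>]) simp
    then show "x \<in> (\<Union>\<sigma>\<in>Pow \<tau>. open_cell J \<sigma> {} m)" by (intro UN_I) auto
  qed
  show "(\<Union>\<sigma>\<in>Pow \<tau>. open_cell J \<sigma> {} m) \<subseteq> closed_cell J \<tau> m"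
  proof
    fix x assume "x \<in> (\<Union>\<sigma>\<in>Pow \<tau>. open_cell J \<sigma> {} m)"
    then obtain \<sigma> where s: "\<sigma> \<subseteq> \<tau>" and "x \<in> open_cell J \<sigma> {} m" by blast
    then obtain \<alpha> where x: "x = point_sum \<sigma> \<alpha>" and \<alpha>: "\<forall>p\<in>\<sigma>. 0 < \<alpha> p"
        "\<forall>j\<in>J. label_sum \<sigma> \<alpha> j = real (m j)"
      unfolding open_cell_def by blast
    show "x \<in> closed_cell J \<tau> m"
      unfolding closed_cell_def mem_Collect_eq
      by (rule exI[of _ "\<lambda>p. if p \<in> \<sigma> then \<alpha> p else 0"])
        (use \<alpha> in \<open>auto simp: sums_zero_extend[OF assms s] x\<close>)
  qed
qed

lemma open_cells_disjoint:
  fixes \<tau> :: "('j \<times> (real ^ 'd)) set"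
  assumes "cayley_independent J \<tau>" "finite \<tau>" "\<sigma> \<subseteq> \<tau>" "\<sigma>' \<subseteq> \<tau>" "\<sigma> \<noteq> \<sigma>'"
  shows "open_cell J \<sigma> {} m \<inter> open_cell J \<sigma>' {} m = {}"
proof (rule ccontr)
  assume "\<not> ?thesis"
  then obtain x where "x \<in> open_cell J \<sigma> {} m" "x \<in> open_cell J \<sigma>' {} m" by blast
  then obtain \<alpha> \<beta> where eq: "point_sum \<sigma> \<alpha> = point_sum \<sigma>' \<beta>"
    and \<alpha>: "\<forall>p\<in>\<sigma>. 0 < \<alpha> p" "\<forall>j\<in>J. label_sum \<sigma> \<alpha> j = real (m j)"
    and \<beta>: "\<forall>p\<in>\<sigma>'. 0 < \<beta> p" "\<forall>j\<in>J. label_sum \<sigma>' \<beta> j = real (m j)"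
    unfolding open_cell_def by auto
  have "(if p \<in> \<sigma> then \<alpha> p else 0) = (if p \<in> \<sigma>' then \<beta> p else 0)" if "p \<in> \<tau>" for p
    by (rule cayley_independent_unique[OF assms(1) _ _ that])
      (use \<alpha>(2) \<beta>(2) eq in \<open>simp_all add: sums_zero_extend[OF assms(2,3)] sums_zero_extend[OF assms(2,4)]\<close>)
  then have "p \<in> \<sigma> \<longleftrightarrow> p \<in> \<sigma>'" if "p \<in> \<tau>" for p
    using that \<alpha>(1) \<beta>(1) by (metis less_irrefl)
  then show False using assms(3-5) by blast
qed

lemma open_cell_missing_label:
  assumes "j \<in> J" "j \<notin> fst ` \<tau>" "m j > 0"
  shows "open_cell J \<tau> B m = {}"
proof -
  have e: "{p. p \<in> \<tau> \<and> fst p = j} = {}" using assms(2) by (auto simp: image_iff)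
  have "label_sum \<tau> \<alpha> j = 0" for \<alpha> unfolding label_sum_def e by simp
  then have "label_sum \<tau> \<alpha> j \<noteq> real (m j)" for \<alpha> using assms(3) by simp
  then show ?thesis using assms(1) unfolding open_cell_def by blast
qed

lemma open_cell_zero_label:
  assumes "finite \<tau>" "j \<in> J" "j \<in> fst ` \<tau>" "m j = 0"
  shows "open_cell J \<tau> B m = {}"
proof -
  obtain q where q: "q \<in> \<tau>" "fst q = j" using assms(3) by blast
  have "label_sum \<tau> \<alpha> j > 0" if "\<forall>p\<in>\<tau>. 0 < \<alpha> p" for \<alpha>
    unfolding label_sum_def using that q assms(1) by (intro sum_pos) (simp_all, metis prod.collapse)
  then have "label_sum \<tau> \<alpha> j \<noteq> real (m j)" if "\<forall>p\<in>\<tau>. 0 < \<alpha> p" for \<alpha>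
    using that assms(4) by (metis less_irrefl of_nat_0)
  then show ?thesis using assms(2) unfolding open_cell_def by blast
qed

text \<open>Coefficients of at most 1 cannot exceed the number of generators in total. This is where
  the recursion over capped generators stops.\<close>

lemma open_cell_full_label:
  assumes "finite \<tau>" "j \<in> J" "{p \<in> \<tau>. fst p = j} \<subseteq> B" "m j > card {p \<in> \<tau>. fst p = j}"
  shows "open_cell J \<tau> B m = {}"
proof -
  have "label_sum \<tau> \<alpha> j \<le> real (card {p \<in> \<tau>. fst p = j})" if "\<forall>p\<in>B. \<alpha> p \<le> 1" for \<alpha>
    unfolding label_sum_def using that assms(3)
      sum_bounded_above[of "{p \<in> \<tau>. fst p = j}" \<alpha> 1] by fastforce
  then have "label_sum \<tau> \<alpha> j \<noteq> real (m j)" if "\<forall>p\<in>B. \<alpha> p \<le> 1" for \<alpha>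
    using that assms(4) by fastforce
  then show ?thesis using assms(2) unfolding open_cell_def by blast
qed

text \<open>The summands with \<open>\<alpha> q > 1\<close> are the translate by \<open>snd q\<close>.\<close>

lemma open_cell_step:
  fixes \<tau> :: "('j \<times> (real ^ 'd)) set"
  assumes ind: "cayley_independent J \<tau>" and fin: "finite \<tau>" and B: "B \<subseteq> \<tau>" and q: "q \<in> \<tau> - B"
    and m': "m' = m(fst q := Suc (m (fst q)))"
  shows "open_cell J \<tau> B m' = (\<lambda>p. p + snd q) ` open_cell J \<tau> B m \<union> open_cell J \<tau> (insert q B) m'"
      (is "_ = ?T \<union> _")
    and "(\<lambda>p. p + snd q) ` open_cell J \<tau> B m \<inter> open_cell J \<tau> (insert q B) m' = {}"
proof -
  let ?\<delta> = "\<lambda>p. if p = q then 1 else (0::real)"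
  have q': "q \<in> \<tau>" using q by simp
  note delta = point_sum_delta[OF fin q'] label_sum_delta[OF fin q']
  have T: "?T = {point_sum \<tau> \<alpha> | \<alpha>. (\<forall>p\<in>\<tau>. 0 < \<alpha> p) \<and> 1 < \<alpha> q \<and> (\<forall>p\<in>B. \<alpha> p \<le> 1) \<and>
     (\<forall>j\<in>J. label_sum \<tau> \<alpha> j = real (m' j))}" (is "_ = ?R")
  proof
    show "?T \<subseteq> ?R"
    proof
      fix y assume "y \<in> ?T"
      then obtain \<alpha> where y: "y = point_sum \<tau> \<alpha> + snd q" and \<alpha>: "\<forall>p\<in>\<tau>. 0 < \<alpha> p" "\<forall>p\<in>B. \<alpha> p \<le> 1"
        "\<forall>j\<in>J. label_sum \<tau> \<alpha> j = real (m j)"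
        unfolding open_cell_def by blast
      show "y \<in> ?R" unfolding mem_Collect_eq
        by (rule exI[of _ "\<lambda>p. \<alpha> p + ?\<delta> p"])
          (use \<alpha> q in \<open>auto simp: point_sum_linear label_sum_linear delta y m' intro: add_pos_nonneg\<close>)
    qed
    show "?R \<subseteq> ?T"
    proof
      fix y assume "y \<in> ?R"
      then obtain \<alpha> where y: "y = point_sum \<tau> \<alpha>" and \<alpha>: "\<forall>p\<in>\<tau>. 0 < \<alpha> p" "1 < \<alpha> q" "\<forall>p\<in>B. \<alpha> p \<le> 1"
        "\<forall>j\<in>J. label_sum \<tau> \<alpha> j = real (m' j)" by blast
      have "point_sum \<tau> (\<lambda>p. \<alpha> p - ?\<delta> p) \<in> open_cell J \<tau> B m"
        unfolding open_cell_def mem_Collect_eq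
        by (rule exI[of _ "\<lambda>p. \<alpha> p - ?\<delta> p"]) (use \<alpha> q in \<open>auto simp: label_sum_linear delta m'\<close>)
      moreover have "y = point_sum \<tau> (\<lambda>p. \<alpha> p - ?\<delta> p) + snd q"
        by (simp add: y point_sum_linear delta)
      ultimately show "y \<in> ?T" by blast
    qed
  qed
  show "open_cell J \<tau> B m' = ?T \<union> open_cell J \<tau> (insert q B) m'"
  proof -
    have "1 < \<alpha> q \<or> \<alpha> q \<le> 1" for \<alpha> :: "'j \<times> (real ^ 'd) \<Rightarrow> real" by linarith
    then show ?thesis unfolding T unfolding open_cell_def by blast
  qed
  \<comment> \<open>Independence enters here: otherwise a point could have one representation with
    the coefficient of \<open>q\<close> above 1 and another with it at most 1.\<close>
  show "?T \<inter> open_cell J \<tau> (insert q B) m' = {}"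
  proof (rule ccontr)
    assume "\<not> ?thesis"
    then obtain \<alpha> \<beta> where "point_sum \<tau> \<alpha> = point_sum \<tau> \<beta>" "1 < \<alpha> q" "\<beta> q \<le> 1"
      "\<forall>j\<in>J. label_sum \<tau> \<alpha> j = real (m' j)" "\<forall>j\<in>J. label_sum \<tau> \<beta> j = real (m' j)"
      unfolding T unfolding open_cell_def by auto
    then show False using cayley_independent_unique[OF ind, of \<alpha> \<beta> q] q' by simp
  qed
qed

section \<open>Sets whose valuation is polynomial under translation\<close>

text \<open>Membership of all lattice translates in the ring is carried along, since
  \<open>\<mu>\<close> is additive only there; the class is then closed under proper differences and
  finite disjoint unions.\<close>

definition translation_polynomial :: "((real ^ 'd) set \<Rightarrow> real) \<Rightarrow> nat \<Rightarrow> (real ^ 'd) set \<Rightarrow> bool" where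
  "translation_polynomial \<mu> K S \<longleftrightarrow> (\<forall>x\<in>int_lattice. (\<lambda>p. p + x) ` S \<in> integer_polytope_ring) \<and>
     vanishing_differences K (\<lambda>x. \<mu> ((\<lambda>p. p + x) ` S))"

lemma translation_polynomial_in_ring:
  "translation_polynomial \<mu> K S \<Longrightarrow> S \<in> integer_polytope_ring"
  unfolding translation_polynomial_def using int_lattice_zero by fastforce

lemma translation_polynomial_polytope:
  assumes "polynomial_valuation k \<mu>" "convex_integer_polytope P"
  shows "translation_polynomial \<mu> (Suc k) P"
  using assms convex_integer_polytope_translate
  unfolding translation_polynomial_def polynomial_valuation_def
  by (blast intro: integer_polytope_in_ring polynomial_vanishing_differences)

lemma translation_polynomial_Diff:
  assumes \<mu>: "integer_polytope_valuation \<mu>"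
    and "translation_polynomial \<mu> K S" "translation_polynomial \<mu> K T" "T \<subseteq> S"
  shows "translation_polynomial \<mu> K (S - T)"
proof -
  have image: "(\<lambda>p. p + x) ` (S - T) = (\<lambda>p. p + x) ` S - (\<lambda>p. p + x) ` T" for x
    by (rule image_set_diff) (simp add: inj_def)
  have "vanishing_differences K (\<lambda>x. \<mu> ((\<lambda>p. p + x) ` S) - \<mu> ((\<lambda>p. p + x) ` T))"
    using assms unfolding translation_polynomial_def by (intro vanishing_differences_diff) auto
  then have "vanishing_differences K (\<lambda>x. \<mu> ((\<lambda>p. p + x) ` (S - T)))"
    by (rule vanishing_differences_cong)
      (use assms in \<open>auto simp: image translation_polynomial_def intro!: valuation_Diff[OF \<mu>]\<close>)
  then show ?thesis using assms unfolding translation_polynomial_def image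
    by (auto intro: integer_polytope_ring_Diff)
qed

lemma translation_polynomial_translate:
  assumes "translation_polynomial \<mu> K S" "v \<in> int_lattice"
  shows "translation_polynomial \<mu> K ((\<lambda>p. p + v) ` S)"
proof -
  have "(\<lambda>p. p + x) ` (\<lambda>p. p + v) ` S = (\<lambda>p. p + (x + v)) ` S" for x
    by (simp add: image_image add_ac)
  then show ?thesis
    using assms vanishing_differences_shift[of K "\<lambda>x. \<mu> ((\<lambda>p. p + x) ` S)" v]
    unfolding translation_polynomial_def by (simp add: int_lattice_add)
qed

lemma translation_polynomial_empty:
  assumes "integer_polytope_valuation \<mu>"
  shows "translation_polynomial \<mu> K {}"
  unfolding translation_polynomial_def
  by (auto simp: integer_polytope_ring_empty valuation_empty[OF assms] intro: vanishing_differences_zero)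

lemma translation_polynomial_UN:
  assumes \<mu>: "integer_polytope_valuation \<mu>" and "finite I"
    and F: "\<And>i. i \<in> I \<Longrightarrow> translation_polynomial \<mu> K (F i)"
    and disj: "\<And>i j. i \<in> I \<Longrightarrow> j \<in> I \<Longrightarrow> i \<noteq> j \<Longrightarrow> F i \<inter> F j = {}"
  shows "translation_polynomial \<mu> K (\<Union>i\<in>I. F i)"
proof -
  have ring: "(\<lambda>p. p + x) ` F i \<in> integer_polytope_ring" if "x \<in> int_lattice" "i \<in> I" for x i
    using F that unfolding translation_polynomial_def by blast
  have d: "(\<lambda>p. p + x) ` F i \<inter> (\<lambda>p. p + x) ` F j = {}" if "i \<in> I" "j \<in> I" "i \<noteq> j" for x i j
    using disj[OF that] by auto
  have *: "(\<lambda>p. p + x) ` (\<Union>i\<in>I. F i) = (\<Union>i\<in>I. (\<lambda>p. p + x) ` F i)" for x by (rule image_UN)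
  have "vanishing_differences K (\<lambda>x. \<Sum>i\<in>I. \<mu> ((\<lambda>p. p + x) ` F i))"
    using F unfolding translation_polynomial_def by (intro vanishing_differences_sum) auto
  then have "vanishing_differences K (\<lambda>x. \<mu> ((\<lambda>p. p + x) ` (\<Union>i\<in>I. F i)))"
    by (rule vanishing_differences_cong)
      (unfold *, rule valuation_UN[OF \<mu> assms(2) ring d, THEN conjunct2])
  moreover have "(\<lambda>p. p + x) ` (\<Union>i\<in>I. F i) \<in> integer_polytope_ring" if "x \<in> int_lattice" for x
    unfolding * by (rule valuation_UN[OF \<mu> assms(2) ring d, THEN conjunct1]) (use that in auto)
  ultimately show ?thesis unfolding translation_polynomial_def by blast
qed

text \<open>Induction over faces: an open cell is a closed cell, which is a lattice polytope, minus
  the disjoint open cells of the proper subsets of generators.\<close>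

lemma translation_polynomial_open_cell_positive:
  fixes \<tau> :: "('j \<times> (real ^ 'd)) set"
  assumes \<mu>: "polynomial_valuation k \<mu>" and "cayley_independent J \<tau>" "finite \<tau>" "finite J"
    and "fst ` \<tau> \<subseteq> J" "snd ` \<tau> \<subseteq> int_lattice" "\<forall>j\<in>J. m j > 0"
  shows "translation_polynomial \<mu> (Suc k) (open_cell J \<tau> {} m)"
  using assms(2-)
proof (induction "card \<tau>" arbitrary: \<tau> rule: less_induct)
  case less
  have \<mu>': "integer_polytope_valuation \<mu>" using \<mu> unfolding polynomial_valuation_def by blast
  let ?U = "\<Union>\<sigma>\<in>Pow \<tau> - {\<tau>}. open_cell J \<sigma> {} m"
  have disj: "open_cell J \<sigma> {} m \<inter> open_cell J \<sigma>' {} m = {}"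
    if "\<sigma> \<in> Pow \<tau>" "\<sigma>' \<in> Pow \<tau>" "\<sigma> \<noteq> \<sigma>'" for \<sigma> \<sigma>'
    using open_cells_disjoint[OF less.prems(1,2)] that by blast
  have closed: "closed_cell J \<tau> m = open_cell J \<tau> {} m \<union> ?U"
    unfolding closed_cell_faces[OF less.prems(2)] by blast
  moreover have "open_cell J \<tau> {} m \<inter> ?U = {}" using disj[of \<tau>] by blast
  ultimately have diff: "open_cell J \<tau> {} m = closed_cell J \<tau> m - ?U" by blast
  have "translation_polynomial \<mu> (Suc k) (open_cell J \<sigma> {} m)" if "\<sigma> \<in> Pow \<tau> - {\<tau>}" for \<sigma>
  proof (rule less.hyps)
    show "card \<sigma> < card \<tau>" using that less.prems(2) by (intro psubset_card_mono) auto
    show "cayley_independent J \<sigma>" using cayley_independent_subset that less.prems(1,2) by blast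
    show "finite \<sigma>" using that less.prems(2) finite_subset by blast
    show "fst ` \<sigma> \<subseteq> J" "snd ` \<sigma> \<subseteq> int_lattice"
      using that less.prems(4,5) by blast+
  qed (use less.prems in auto)
  then have "translation_polynomial \<mu> (Suc k) ?U"
    using less.prems(2) disj by (intro translation_polynomial_UN[OF \<mu>']) auto
  moreover have "translation_polynomial \<mu> (Suc k) (closed_cell J \<tau> m)"
    using less.prems by (intro translation_polynomial_polytope[OF \<mu>] convex_integer_polytope_closed_cell)
  ultimately show ?case unfolding diff using closed by (intro translation_polynomial_Diff[OF \<mu>']) auto
qed

lemma translation_polynomial_open_cell:
  fixes \<tau> :: "('j \<times> (real ^ 'd)) set"
  assumes \<mu>: "polynomial_valuation k \<mu>" and ind: "cayley_independent J \<tau>" and fin: "finite \<tau>" "finite J"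
    and J: "fst ` \<tau> = J" and int: "snd ` \<tau> \<subseteq> int_lattice" and B: "B \<subseteq> \<tau>"
  shows "translation_polynomial \<mu> (Suc k) (open_cell J \<tau> B m)"
  using finite_subset[OF B fin(1)] B
proof (induction B arbitrary: m rule: finite_induct)
  have \<mu>': "integer_polytope_valuation \<mu>" using \<mu> unfolding polynomial_valuation_def by blast
  note empty_cell = translation_polynomial_empty[OF \<mu>']
  {
    case empty
    show ?case
    proof (cases "\<forall>j\<in>J. m j > 0")
      case True
      then show ?thesis using translation_polynomial_open_cell_positive[OF \<mu> ind fin] J int by simp
    next
      case False
      then obtain j where "j \<in> J" "m j = 0" by blast
      then show ?thesis using open_cell_zero_label[OF fin(1), of j J m] J empty_cell by simp
    qed
  next
    case (insert q B)
    have q: "q \<in> \<tau>" "fst q \<in> J" "snd q \<in> int_lattice" using insert.prems J int by auto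
    show ?case
    proof (cases "m (fst q) = 0")
      case True
      then show ?thesis using open_cell_zero_label[OF fin(1), of "fst q" J m] q J empty_cell by simp
    next
      case False
      \<comment> \<open>\<open>open_cell_step\<close> is phrased as an increase, so the argument is
        lowered beforehand.\<close>
      define m0 where "m0 = m(fst q := m (fst q) - 1)"
      have m: "m = m0(fst q := Suc (m0 (fst q)))" using False by (auto simp: m0_def)
      have "open_cell J \<tau> (insert q B) m =
          open_cell J \<tau> B m - (\<lambda>p. p + snd q) ` open_cell J \<tau> B m0"
        "(\<lambda>p. p + snd q) ` open_cell J \<tau> B m0 \<subseteq> open_cell J \<tau> B m"
        using open_cell_step[OF ind fin(1) _ _ m, of B] insert by blast+
      then show ?thesis
        using insert q
        by (simp add: translation_polynomial_Diff[OF \<mu>'] translation_polynomial_translate)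
    qed
  }
qed

lemma open_cell_polynomial:
  fixes \<tau> :: "('j \<times> (real ^ 'd)) set"
  assumes \<mu>: "polynomial_valuation k \<mu>" and ind: "cayley_independent J \<tau>" and fin: "finite \<tau>" "finite J"
    and J: "fst ` \<tau> = J" and int: "snd ` \<tau> \<subseteq> int_lattice"
  shows "polynomial_below J (Suc k + card \<tau> - card J) (\<lambda>m. \<mu> (open_cell J \<tau> {} m))"
proof -
  have \<mu>': "integer_polytope_valuation \<mu>" using \<mu> unfolding polynomial_valuation_def by blast
  \<comment> \<open>Splitting off \<open>q\<close> leaves a capped cell at the increased argument;
    counting the capped generators into the argument absorbs this increase, and the recursion gets
    the required form. Once all generators of a label are capped, the argument exceeds their number
    for every positive \<open>m\<close>, so the cell is empty.\<close>
  define M where "M B m j = m j + card {p \<in> B. fst p = j}" for B :: "('j \<times> (real ^ 'd)) set" and m j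
  define G where "G B m x = \<mu> ((\<lambda>p. p + x) ` open_cell J \<tau> B (M B m))" for B m x
  note tp = translation_polynomial_open_cell[OF \<mu> ind fin J int]
  have "polynomial_below J (Suc k + card (\<tau> - {}) - card J) (\<lambda>m. G {} m 0)"
  proof (rule polynomial_below_shift_recursion[where cl = fst and v = snd])
    show "G B m x = G B m' x" if "\<And>j. j \<in> J \<Longrightarrow> m j = m' j" for B m m' x
    proof -
      have "open_cell J \<tau> B (M B m) = open_cell J \<tau> B (M B m')"
        using that unfolding open_cell_def M_def by auto
      then show ?thesis by (simp add: G_def)
    qed
    show "G B (m(fst q := Suc (m (fst q)))) x = G B m (x + snd q) + G (insert q B) m x"
      if B: "B \<subseteq> \<tau>" and q: "q \<in> \<tau> - B" and x: "x \<in> int_lattice" for B q m x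
    proof -
      let ?m = "(M B m)(fst q := Suc (M B m (fst q)))"
      have m1: "M B (m(fst q := Suc (m (fst q)))) = ?m" by (auto simp: M_def)
      have finB: "finite {p \<in> B. fst p = j}" for j using finite_subset[OF B fin(1)] by simp
      have "{p \<in> insert q B. fst p = j} = (if fst q = j then insert q {p \<in> B. fst p = j} else {p \<in> B. fst p = j})"
        for j by auto
      then have m2: "M (insert q B) m = ?m" using q finB by (auto simp: M_def fun_eq_iff)
      note step = open_cell_step[OF ind fin(1) B q refl, of "M B m"]
      have image: "(\<lambda>p. p + x) ` (\<lambda>p. p + snd q) ` S = (\<lambda>p. p + (x + snd q)) ` S" for S
        by (simp add: image_image add_ac)
      have "(\<lambda>p. p + x) ` (\<lambda>p. p + snd q) ` open_cell J \<tau> B (M B m) \<in> integer_polytope_ring"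
        "(\<lambda>p. p + x) ` open_cell J \<tau> (insert q B) ?m \<in> integer_polytope_ring"
        using tp[of B "M B m"] tp[of "insert q B" ?m] B q x int
        unfolding image translation_polynomial_def by (auto simp: int_lattice_add)
      then have "\<mu> ((\<lambda>p. p + x) ` open_cell J \<tau> B ?m) =
          \<mu> ((\<lambda>p. p + x) ` (\<lambda>p. p + snd q) ` open_cell J \<tau> B (M B m)) +
          \<mu> ((\<lambda>p. p + x) ` open_cell J \<tau> (insert q B) ?m)"
        unfolding step(1) image_Un by (rule valuation_Un[OF \<mu>']) (use step(2) in auto)
      then show ?thesis unfolding G_def m1 m2 image .
    qed
    show "G B m x = 0"
      if "B \<subseteq> \<tau>" "j \<in> J" "{i \<in> \<tau>. fst i = j} \<subseteq> B" "\<forall>j\<in>J. m j > 0" for B j m x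
    proof -
      have "{p \<in> B. fst p = j} = {p \<in> \<tau>. fst p = j}" using that by blast
      then have "open_cell J \<tau> B (M B m) = {}"
        using that by (intro open_cell_full_label[OF fin(1)]) (auto simp: M_def)
      then show ?thesis by (simp add: G_def valuation_empty[OF \<mu>'])
    qed
    show "vanishing_differences (Suc k) (G B m)" if "B \<subseteq> \<tau>" for B m
      using tp[OF that] unfolding translation_polynomial_def G_def by simp
  qed (use fin J int int_lattice_zero in auto)
  moreover have "M {} m = m" for m by (simp add: M_def fun_eq_iff)
  ultimately show ?thesis by (simp add: G_def)
qed

section \<open>The lexicographic triangulation\<close>

text \<open>Plays the part of a height function. It is generic by construction: a vector that is
  neither lexicographically negative nor the negative of such a vector vanishes on the list.\<close>

primrec lex_negative :: "'p list \<Rightarrow> ('p \<Rightarrow> real) \<Rightarrow> bool" where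
  "lex_negative [] \<gamma> = False"
| "lex_negative (p # ps) \<gamma> = (\<gamma> p < 0 \<or> \<gamma> p = 0 \<and> lex_negative ps \<gamma>)"

lemma lex_negative_scale: "c > 0 \<Longrightarrow> lex_negative ps (\<lambda>p. c * \<gamma> p) \<longleftrightarrow> lex_negative ps \<gamma>"
  by (induction ps) (auto simp: mult_less_0_iff)

lemma lex_negative_cong: "(\<And>p. p \<in> set ps \<Longrightarrow> \<gamma> p = \<delta> p) \<Longrightarrow> lex_negative ps \<gamma> \<longleftrightarrow> lex_negative ps \<delta>"
  by (induction ps) auto

lemma lex_negative_trichotomy:
  "\<not> lex_negative ps \<gamma> \<Longrightarrow> \<not> lex_negative ps (\<lambda>p. - \<gamma> p) \<Longrightarrow> p \<in> set ps \<Longrightarrow> \<gamma> p = 0"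
  by (induction ps) auto

text \<open>Minimise the first coordinate, pass to the set of its minimisers, which is again
  compact, and go on with the next coordinate.\<close>

lemma lex_minimum_exists:
  fixes \<Phi> :: "('p \<Rightarrow> real) set"
  assumes "compact \<Phi>" "\<Phi> \<noteq> {}"
  shows "\<exists>\<alpha>\<in>\<Phi>. \<forall>\<beta>\<in>\<Phi>. \<not> lex_negative ps (\<lambda>p. \<beta> p - \<alpha> p)"
  using assms
proof (induction ps arbitrary: \<Phi>)
  case Nil
  then show ?case by auto
next
  case (Cons p ps)
  have cont: "continuous_on UNIV (\<lambda>\<alpha> :: 'p \<Rightarrow> real. \<alpha> p)" by (rule continuous_on_product_coordinates)
  then obtain \<alpha>0 where \<alpha>0: "\<alpha>0 \<in> \<Phi>" "\<And>\<beta>. \<beta> \<in> \<Phi> \<Longrightarrow> \<alpha>0 p \<le> \<beta> p"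
    using continuous_attains_inf[OF Cons.prems, of "\<lambda>\<alpha>. \<alpha> p"] continuous_on_subset by blast
  have "closed {\<alpha> :: 'p \<Rightarrow> real. \<alpha> p = \<alpha>0 p}"
    using cont by (intro closed_Collect_eq continuous_on_const)
  then have "compact (\<Phi> \<inter> {\<alpha>. \<alpha> p = \<alpha>0 p})" using Cons.prems by (intro compact_Int_closed)
  with Cons.IH[of "\<Phi> \<inter> {\<alpha>. \<alpha> p = \<alpha>0 p}"] \<alpha>0 obtain \<alpha> where
    \<alpha>: "\<alpha> \<in> \<Phi>" "\<alpha> p = \<alpha>0 p" "\<And>\<beta>. \<beta> \<in> \<Phi> \<Longrightarrow> \<beta> p = \<alpha>0 p \<Longrightarrow> \<not> lex_negative ps (\<lambda>p. \<beta> p - \<alpha> p)"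
    by auto
  have "\<not> lex_negative (p # ps) (\<lambda>p. \<beta> p - \<alpha> p)" if "\<beta> \<in> \<Phi>" for \<beta>
    using \<alpha>(2) \<alpha>(3)[OF that] \<alpha>0(2)[OF that] by auto
  then show ?case using \<alpha>(1) by blast
qed

text \<open>Whether a nonnegative \<open>\<alpha>\<close> is lexicographically minimal among the representations of a point
  depends only on its support. The supports that occur form a regular triangulation
  of the Cayley configuration, and they do not depend on \<open>m\<close>.\<close>

definition lex_triangulation :: "'j set \<Rightarrow> ('j \<times> (real ^ 'd)) list \<Rightarrow> ('j \<times> (real ^ 'd)) set set" where
  "lex_triangulation J ps = {\<tau>. \<tau> \<subseteq> set ps \<and> \<not> (\<exists>\<gamma>. lex_negative ps \<gamma> \<and> (\<forall>p\<in>set ps - \<tau>. 0 \<le> \<gamma> p) \<and>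
     point_sum (set ps) \<gamma> = 0 \<and> (\<forall>j\<in>J. label_sum (set ps) \<gamma> j = 0))}"

text \<open>A relation supported on \<open>\<tau>\<close> meets no sign condition outside
  \<open>\<tau>\<close>, and neither does its negative. Unless it is zero, one of the two would be a
  forbidden improvement.\<close>

lemma lex_triangulation_independent:
  assumes "\<tau> \<in> lex_triangulation J ps"
  shows "cayley_independent J \<tau>"
  unfolding cayley_independent_def
proof (intro allI impI ballI)
  fix \<gamma> p assume \<gamma>: "point_sum \<tau> \<gamma> = 0 \<and> (\<forall>j\<in>J. label_sum \<tau> \<gamma> j = 0)" and p: "p \<in> \<tau>"
  have \<tau>: "\<tau> \<subseteq> set ps" and no: "\<And>\<gamma>. lex_negative ps \<gamma> \<Longrightarrow> (\<forall>p\<in>set ps - \<tau>. 0 \<le> \<gamma> p) \<Longrightarrow>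
      point_sum (set ps) \<gamma> = 0 \<Longrightarrow> (\<forall>j\<in>J. label_sum (set ps) \<gamma> j = 0) \<Longrightarrow> False"
    using assms unfolding lex_triangulation_def by blast+
  define \<delta> where "\<delta> p = (if p \<in> \<tau> then \<gamma> p else 0)" for p
  have \<delta>: "point_sum (set ps) \<delta> = 0" "\<forall>j\<in>J. label_sum (set ps) \<delta> j = 0"
    using \<gamma> sums_zero_extend[OF _ \<tau>, of \<gamma>] unfolding \<delta>_def by simp_all
  have "\<not> lex_negative ps \<delta>"
    by (rule notI, rule no) (use \<delta> in \<open>auto simp: \<delta>_def\<close>)
  moreover have "\<not> lex_negative ps (\<lambda>p. - \<delta> p)"
    by (rule notI, rule no[of "\<lambda>p. - \<delta> p"])
      (use \<delta> in \<open>simp_all add: point_sum_linear label_sum_linear, simp add: \<delta>_def\<close>)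
  ultimately have "\<delta> p = 0" by (rule lex_negative_trichotomy) (use p \<tau> in blast)
  then show "\<gamma> p = 0" using p by (simp add: \<delta>_def)
qed

text \<open>The difference of two representations of a common point is nonnegative off
  \<open>\<tau>\<close>, and its negative is nonnegative off \<open>\<tau>'\<close>. By minimality
  neither is lexicographically negative, so the representations and their supports agree.\<close>

lemma lex_triangulation_disjoint:
  assumes "\<tau> \<in> lex_triangulation J ps" "\<tau>' \<in> lex_triangulation J ps" "\<tau> \<noteq> \<tau>'"
  shows "open_cell J \<tau> {} m \<inter> open_cell J \<tau>' {} m = {}"
proof (rule ccontr)
  assume "\<not> ?thesis"
  then obtain x where x: "x \<in> open_cell J \<tau> {} m" "x \<in> open_cell J \<tau>' {} m" by blast
  have rep: "\<exists>\<alpha>. point_sum (set ps) \<alpha> = x \<and> (\<forall>p\<in>\<sigma>. 0 < \<alpha> p) \<and> (\<forall>p. p \<notin> \<sigma> \<longrightarrow> \<alpha> p = 0) \<and>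
      (\<forall>j\<in>J. label_sum (set ps) \<alpha> j = real (m j))"
    if "\<sigma> \<in> lex_triangulation J ps" "x \<in> open_cell J \<sigma> {} m" for \<sigma>
  proof -
    have \<sigma>: "\<sigma> \<subseteq> set ps" using that(1) unfolding lex_triangulation_def by blast
    from that(2) obtain \<alpha> where "x = point_sum \<sigma> \<alpha>" "\<forall>p\<in>\<sigma>. 0 < \<alpha> p"
      "\<forall>j\<in>J. label_sum \<sigma> \<alpha> j = real (m j)" unfolding open_cell_def by blast
    then show ?thesis
      by (intro exI[of _ "\<lambda>p. if p \<in> \<sigma> then \<alpha> p else 0"]) (simp add: sums_zero_extend[OF _ \<sigma>])
  qed
  obtain \<alpha> where \<alpha>: "point_sum (set ps) \<alpha> = x" "\<And>p. p \<in> \<tau> \<Longrightarrow> 0 < \<alpha> p" "\<And>p. p \<notin> \<tau> \<Longrightarrow> \<alpha> p = 0"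
      "\<And>j. j \<in> J \<Longrightarrow> label_sum (set ps) \<alpha> j = real (m j)"
    using rep[OF assms(1) x(1)] by blast
  obtain \<beta> where \<beta>: "point_sum (set ps) \<beta> = x" "\<And>p. p \<in> \<tau>' \<Longrightarrow> 0 < \<beta> p" "\<And>p. p \<notin> \<tau>' \<Longrightarrow> \<beta> p = 0"
      "\<And>j. j \<in> J \<Longrightarrow> label_sum (set ps) \<beta> j = real (m j)"
    using rep[OF assms(2) x(2)] by blast
  have nn: "0 \<le> \<alpha> p" "0 \<le> \<beta> p" for p using \<alpha>(2,3)[of p] \<beta>(2,3)[of p] by force+
  have "\<not> lex_negative ps (\<lambda>p. \<beta> p - \<alpha> p)"
    using assms(1) \<alpha> \<beta> nn unfolding lex_triangulation_def
    by (auto simp: point_sum_linear label_sum_linear dest!: spec[of _ "\<lambda>p. \<beta> p - \<alpha> p"])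
  moreover have "\<not> lex_negative ps (\<lambda>p. - (\<beta> p - \<alpha> p))"
    using assms(2) \<alpha> \<beta> nn unfolding lex_triangulation_def
    by (auto simp: point_sum_linear label_sum_linear dest!: spec[of _ "\<lambda>p. \<alpha> p - \<beta> p"])
  ultimately have eq: "\<beta> p = \<alpha> p" if "p \<in> set ps" for p
    using lex_negative_trichotomy[of ps "\<lambda>p. \<beta> p - \<alpha> p" p] that by auto
  have "p \<in> \<tau> \<longleftrightarrow> p \<in> \<tau>'" if "p \<in> set ps" for p
    using eq[OF that] \<alpha>(2,3)[of p] \<beta>(2,3)[of p] by force
  moreover have "\<tau> \<subseteq> set ps" "\<tau>' \<subseteq> set ps" using assms unfolding lex_triangulation_def by blast+
  ultimately show False using assms(3) by blast
qed

text \<open>The label sums bound every coefficient by a value of \<open>m\<close>, so this is a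
  closed part of a box, compact by Tychonoff. Entries outside \<open>I\<close> are pinned to 0
  because the functions live on the whole type.\<close>

lemma compact_representations:
  fixes I :: "('j \<times> (real ^ 'd)) set"
  assumes fin: "finite I" and J: "fst ` I \<subseteq> J"
  shows "compact {\<alpha>. (\<forall>p\<in>I. 0 \<le> \<alpha> p) \<and> (\<forall>p. p \<notin> I \<longrightarrow> \<alpha> p = 0) \<and> point_sum I \<alpha> = x \<and>
    (\<forall>j\<in>J. label_sum I \<alpha> j = real (m j))}" (is "compact ?\<Phi>")
proof -
  let ?B = "\<lambda>p. if p \<in> I then {0..real (m (fst p))} else {0}"
  let ?C = "{\<alpha>. point_sum I \<alpha> = x} \<inter> (\<Inter>j\<in>J. {\<alpha>. label_sum I \<alpha> j = real (m j)})"
  have "compactin (product_topology (\<lambda>p. euclidean) UNIV) (PiE UNIV ?B)"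
    unfolding compactin_PiE by auto
  then have box: "compact (PiE UNIV ?B)" by (simp add: euclidean_product_topology)
  have coord: "continuous_on UNIV (\<lambda>\<alpha> :: 'j \<times> (real ^ 'd) \<Rightarrow> real. \<alpha> p)" for p
    by (rule continuous_on_product_coordinates)
  have "closed ?C"
    unfolding point_sum_def label_sum_def
    by (intro closed_Int closed_INT ballI closed_Collect_eq continuous_intros coord)
  then have "compact (PiE UNIV ?B \<inter> ?C)" using box by (intro compact_Int_closed)
  moreover have "PiE UNIV ?B \<inter> ?C = ?\<Phi>"
  proof
    show "PiE UNIV ?B \<inter> ?C \<subseteq> ?\<Phi>"
    proof
      fix \<alpha> assume a: "\<alpha> \<in> PiE UNIV ?B \<inter> ?C"
      have B: "\<alpha> p \<in> ?B p" for p using PiE_mem[of \<alpha> UNIV ?B p] a by blast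
      have "0 \<le> \<alpha> p" if "p \<in> I" for p using that B[of p] by simp
      moreover have "\<alpha> p = 0" if "p \<notin> I" for p using that B[of p] by simp
      moreover have "point_sum I \<alpha> = x" "\<forall>j\<in>J. label_sum I \<alpha> j = real (m j)" using a by auto
      ultimately show "\<alpha> \<in> ?\<Phi>" unfolding mem_Collect_eq by blast
    qed
    show "?\<Phi> \<subseteq> PiE UNIV ?B \<inter> ?C"
    proof
      fix \<alpha> assume a: "\<alpha> \<in> ?\<Phi>"
      then have nn: "\<And>p. p \<in> I \<Longrightarrow> 0 \<le> \<alpha> p" and z: "\<And>p. p \<notin> I \<Longrightarrow> \<alpha> p = 0" by blast+
      have le: "\<alpha> p \<le> real (m (fst p))" if p: "p \<in> I" for p
      proof -
        have "\<alpha> p \<le> label_sum I \<alpha> (fst p)"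
          unfolding label_sum_def using a p fin by (intro member_le_sum) auto
        then show ?thesis using a p J by force
      qed
      have "\<alpha> p \<in> ?B p" for p using nn[of p] z[of p] le[of p] by (cases "p \<in> I") simp_all
      then have "\<alpha> \<in> PiE UNIV ?B" by (simp only: PiE_UNIV_domain Pi_def mem_Collect_eq) blast
      then show "\<alpha> \<in> PiE UNIV ?B \<inter> ?C" using a by blast
    qed
  qed
  ultimately show ?thesis by simp
qed

text \<open>Compactness provides a lexicographically minimal representation. If its support were
  excluded by some relation, a small multiple of that relation could be added and would improve
  it.\<close>

lemma lex_triangulation_cover:
  fixes ps :: "('j \<times> (real ^ 'd)) list"
  assumes J: "fst ` set ps \<subseteq> J"
  shows "closed_cell J (set ps) m = (\<Union>\<tau>\<in>lex_triangulation J ps. open_cell J \<tau> {} m)"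
proof
  let ?I = "set ps"
  show "(\<Union>\<tau>\<in>lex_triangulation J ps. open_cell J \<tau> {} m) \<subseteq> closed_cell J ?I m"
    unfolding closed_cell_faces[OF finite_set] lex_triangulation_def by blast
  show "closed_cell J ?I m \<subseteq> (\<Union>\<tau>\<in>lex_triangulation J ps. open_cell J \<tau> {} m)"
  proof
    fix x assume "x \<in> closed_cell J ?I m"
    then obtain \<alpha>1 where \<alpha>1: "x = point_sum ?I \<alpha>1" "\<forall>p\<in>?I. 0 \<le> \<alpha>1 p"
        "\<forall>j\<in>J. label_sum ?I \<alpha>1 j = real (m j)"
      unfolding closed_cell_def by blast
    define \<Phi> where "\<Phi> = {\<alpha>. (\<forall>p\<in>?I. 0 \<le> \<alpha> p) \<and> (\<forall>p. p \<notin> ?I \<longrightarrow> \<alpha> p = 0) \<and> point_sum ?I \<alpha> = x \<and>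
      (\<forall>j\<in>J. label_sum ?I \<alpha> j = real (m j))}"
    have "(\<lambda>p. if p \<in> ?I then \<alpha>1 p else 0) \<in> \<Phi>"
      unfolding \<Phi>_def using \<alpha>1 by (simp add: sums_zero_extend)
    moreover have "compact \<Phi>" unfolding \<Phi>_def using J by (intro compact_representations) auto
    ultimately obtain \<alpha> where \<alpha>: "\<alpha> \<in> \<Phi>" and min: "\<And>\<beta>. \<beta> \<in> \<Phi> \<Longrightarrow> \<not> lex_negative ps (\<lambda>p. \<beta> p - \<alpha> p)"
      using lex_minimum_exists[of \<Phi> ps] by blast
    define \<tau> where "\<tau> = {p\<in>?I. 0 < \<alpha> p}"
    have "\<not> (\<exists>\<gamma>. lex_negative ps \<gamma> \<and> (\<forall>p\<in>?I - \<tau>. 0 \<le> \<gamma> p) \<and>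
     point_sum ?I \<gamma> = 0 \<and> (\<forall>j\<in>J. label_sum ?I \<gamma> j = 0))"
    proof
      assume "\<exists>\<gamma>. lex_negative ps \<gamma> \<and> (\<forall>p\<in>?I - \<tau>. 0 \<le> \<gamma> p) \<and>
        point_sum ?I \<gamma> = 0 \<and> (\<forall>j\<in>J. label_sum ?I \<gamma> j = 0)"
      then obtain \<gamma> where \<gamma>: "lex_negative ps \<gamma>" "\<forall>p\<in>?I - \<tau>. 0 \<le> \<gamma> p"
        "point_sum ?I \<gamma> = 0" "\<forall>j\<in>J. label_sum ?I \<gamma> j = 0" by blast
      \<comment> \<open>Keeps \<open>\<alpha> p + \<epsilon> * \<gamma> p\<close> nonnegative on the
        support. The \<open>+ 1\<close> prevents division by zero, and the extra element 1 covers an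
        empty \<open>\<tau>\<close>.\<close>
      define \<epsilon> where "\<epsilon> = Min (insert 1 ((\<lambda>p. \<alpha> p / (\<bar>\<gamma> p\<bar> + 1)) ` \<tau>))"
      have fin: "finite \<tau>" by (simp add: \<tau>_def)
      have \<epsilon>: "\<epsilon> > 0" unfolding \<epsilon>_def using fin by (subst Min_gr_iff) (auto simp: \<tau>_def)
      have "0 \<le> \<alpha> p + \<epsilon> * \<gamma> p" if p: "p \<in> ?I" for p
      proof (cases "p \<in> \<tau>")
        case True
        then have "\<epsilon> \<le> \<alpha> p / (\<bar>\<gamma> p\<bar> + 1)" unfolding \<epsilon>_def using fin by (intro Min_le) auto
        then have "\<epsilon> * (\<bar>\<gamma> p\<bar> + 1) \<le> \<alpha> p" by (simp add: pos_le_divide_eq)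
        moreover have "- (\<epsilon> * \<gamma> p) \<le> \<epsilon> * \<bar>\<gamma> p\<bar>"
          using mult_left_mono[of "- \<gamma> p" "\<bar>\<gamma> p\<bar>" \<epsilon>] \<epsilon> by simp
        ultimately show ?thesis using \<epsilon> by (simp add: distrib_left)
      next
        case False
        then show ?thesis using \<alpha> p \<gamma>(2) \<epsilon> by (simp add: \<Phi>_def)
      qed
      then have "(\<lambda>p. if p \<in> ?I then \<alpha> p + \<epsilon> * \<gamma> p else 0) \<in> \<Phi>"
        using \<alpha> \<gamma>(3,4) unfolding \<Phi>_def
        by (simp add: sums_zero_extend point_sum_linear label_sum_linear)
      from min[OF this] have "\<not> lex_negative ps (\<lambda>p. (if p \<in> ?I then \<alpha> p + \<epsilon> * \<gamma> p else 0) - \<alpha> p)" .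
      moreover have "lex_negative ps (\<lambda>p. (if p \<in> ?I then \<alpha> p + \<epsilon> * \<gamma> p else 0) - \<alpha> p) \<longleftrightarrow>
          lex_negative ps (\<lambda>p. \<epsilon> * \<gamma> p)" by (rule lex_negative_cong) simp
      ultimately show False using lex_negative_scale[OF \<epsilon>] \<gamma>(1) by blast
    qed
    then have "\<tau> \<in> lex_triangulation J ps" unfolding lex_triangulation_def by (auto simp: \<tau>_def)
    moreover have "x \<in> open_cell J \<tau> {} m"
    proof -
      have z: "\<alpha> p = 0" if "p \<in> ?I - \<tau>" for p using that \<alpha> by (force simp: \<Phi>_def \<tau>_def)
      have \<tau>: "\<tau> \<subseteq> ?I" by (simp add: \<tau>_def)
      have "point_sum ?I \<alpha> = point_sum \<tau> \<alpha>" "\<And>j. label_sum ?I \<alpha> j = label_sum \<tau> \<alpha> j"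
        by (rule point_sum_mono_neutral[OF finite_set \<tau> z] label_sum_mono_neutral[OF finite_set \<tau> z]; assumption)+
      then show ?thesis using \<alpha> unfolding \<Phi>_def open_cell_def mem_Collect_eq
        by (intro exI[of _ \<alpha>]) (simp add: \<tau>_def)
    qed
    ultimately show "x \<in> (\<Union>\<tau>\<in>lex_triangulation J ps. open_cell J \<tau> {} m)" by blast
  qed
qed

theorem minkowski_sum_polynomial:
  fixes P :: "'j \<Rightarrow> (real ^ 'd) set"
  assumes \<mu>: "polynomial_valuation k \<mu>" and J: "finite J" and P: "\<And>j. j \<in> J \<Longrightarrow> convex_integer_polytope (P j)"
  shows "polynomial_below J (Suc (k + CARD('d))) (\<lambda>m. \<mu> (\<Sum>j\<in>J. (\<lambda>x. real (m j) *\<^sub>R x) ` P j))"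
proof -
  have \<mu>': "integer_polytope_valuation \<mu>" using \<mu> unfolding polynomial_valuation_def by blast
  have "\<forall>j\<in>J. \<exists>W. finite W \<and> W \<subseteq> int_lattice \<and> P j = convex hull W"
    using P convex_integer_polytope_obtain by metis
  then obtain W where W: "\<And>j. j \<in> J \<Longrightarrow> finite (W j) \<and> W j \<subseteq> int_lattice \<and> P j = convex hull W j"
    by metis
  define I where "I = Sigma J W"
  have fin: "finite I" using J W by (simp add: I_def)
  then obtain ps where ps: "set ps = I" using finite_list by blast
  let ?T = "lex_triangulation J ps"
  have TI: "\<tau> \<subseteq> I" "finite \<tau>" "snd ` \<tau> \<subseteq> int_lattice" "fst ` \<tau> \<subseteq> J" if "\<tau> \<in> ?T" for \<tau>
  proof -
    show I: "\<tau> \<subseteq> I" using that ps unfolding lex_triangulation_def by blast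
    then show "finite \<tau>" using fin finite_subset by blast
    have "fst p \<in> J \<and> snd p \<in> W (fst p)" if "p \<in> \<tau>" for p
      using that I by (auto simp: I_def)
    then show "snd ` \<tau> \<subseteq> int_lattice" "fst ` \<tau> \<subseteq> J" using W by blast+
  qed
  have "?T \<subseteq> Pow I" using TI(1) by blast
  then have Tfin: "finite ?T" using fin finite_subset by blast
  have cell: "(\<Sum>j\<in>J. (\<lambda>x. real (m j) *\<^sub>R x) ` P j) = (\<Union>\<tau>\<in>?T. open_cell J \<tau> {} m)"
    if m: "\<forall>j\<in>J. m j > 0" for m
  proof -
    have "closed_cell J I m = (\<Sum>j\<in>J. (\<lambda>x. real (m j) *\<^sub>R x) ` (convex hull {w. (j, w) \<in> I}))"
      using fin J m by (intro closed_cell_eq_minkowski_sum) (auto simp: I_def)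
    also have "\<dots> = (\<Sum>j\<in>J. (\<lambda>x. real (m j) *\<^sub>R x) ` P j)"
      using W by (intro sum.cong refl) (simp add: I_def)
    finally show ?thesis using lex_triangulation_cover[of ps J m] unfolding ps by (simp add: I_def fst_image_Sigma subset_iff)
  qed
  have "polynomial_below J (Suc (k + CARD('d))) (\<lambda>m. \<Sum>\<tau>\<in>?T. \<mu> (open_cell J \<tau> {} m))"
  proof (rule polynomial_below_sum[OF Tfin])
    fix \<tau> assume \<tau>: "\<tau> \<in> ?T"
    \<comment> \<open>A type that misses a label is empty for positive \<open>m\<close>. For the
      others, independence bounds \<open>card \<tau> - card J\<close> by the dimension.\<close>
    show "polynomial_below J (Suc (k + CARD('d))) (\<lambda>m. \<mu> (open_cell J \<tau> {} m))"
    proof (cases "fst ` \<tau> = J")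
      case True
      note ind = lex_triangulation_independent[OF \<tau>]
      have "Suc k + card \<tau> - card J \<le> Suc (k + CARD('d))"
        using cayley_independent_card[OF ind TI(2)[OF \<tau>] J True] by simp
      with open_cell_polynomial[OF \<mu> ind TI(2)[OF \<tau>] J True TI(3)[OF \<tau>]]
      show ?thesis by (rule polynomial_below_mono)
    next
      case False
      then obtain j where "j \<in> J" "j \<notin> fst ` \<tau>" using TI(4)[OF \<tau>] by blast
      then show ?thesis
        by (intro polynomial_below_zero) (simp add: open_cell_missing_label valuation_empty[OF \<mu>'])
    qed
  qed
  then show ?thesis
  proof (rule polynomial_below_cong)
    fix m :: "'j \<Rightarrow> nat" assume m: "\<forall>j\<in>J. m j > 0"
    have "open_cell J \<tau> {} m \<in> integer_polytope_ring" if "\<tau> \<in> ?T" for \<tau>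
      using translation_polynomial_open_cell_positive[OF \<mu> lex_triangulation_independent[OF that] TI(2)[OF that] J
          TI(4,3)[OF that] m] by (rule translation_polynomial_in_ring)
    then show "\<mu> (\<Sum>j\<in>J. (\<lambda>x. real (m j) *\<^sub>R x) ` P j) = (\<Sum>\<tau>\<in>?T. \<mu> (open_cell J \<tau> {} m))"
      unfolding cell[OF m]
      by (intro valuation_UN[OF \<mu>' Tfin, THEN conjunct2] lex_triangulation_disjoint)
  qed
qed

section \<open>Truncated coconvex polytopes\<close>

text \<open>This form passes easily through Minkowski sums, scalings and truncations: a symmetric
  perturbation of a summand is one of the sum.\<close>

lemma extreme_point_of_iff_symmetric:
  assumes "convex S"
  shows "x extreme_point_of S \<longleftrightarrow> x \<in> S \<and> (\<forall>d. x + d \<in> S \<longrightarrow> x - d \<in> S \<longrightarrow> d = 0)"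
proof (intro iffI conjI allI impI)
  assume x: "x extreme_point_of S"
  then show "x \<in> S" by (simp add: extreme_point_of_def)
  fix d assume d: "x + d \<in> S" "x - d \<in> S"
  show "d = 0"
  proof (rule ccontr)
    assume "d \<noteq> 0"
    have "x - d \<noteq> x + d"
    proof
      assume "x - d = x + d"
      then have "2 *\<^sub>R d = 0" by (simp add: scaleR_2 diff_eq_eq)
      then show False using \<open>d \<noteq> 0\<close> by simp
    qed
    moreover have "x = (1 - 1/2) *\<^sub>R (x - d) + (1/2) *\<^sub>R (x + d)" by (simp add: algebra_simps flip: scaleR_2)
    ultimately have "x \<in> open_segment (x - d) (x + d)"
      unfolding in_segment by (intro conjI exI[of _ "1/2"]) auto
    then show False using x d by (simp add: extreme_point_of_def)
  qed
next
  assume x: "x \<in> S \<and> (\<forall>d. x + d \<in> S \<longrightarrow> x - d \<in> S \<longrightarrow> d = 0)"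
  have "x \<notin> open_segment a b" if ab: "a \<in> S" "b \<in> S" for a b
  proof
    assume "x \<in> open_segment a b"
    then obtain u where u: "a \<noteq> b" "0 < u" "u < 1" "x = (1 - u) *\<^sub>R a + u *\<^sub>R b"
      unfolding in_segment by blast
    \<comment> \<open>The smaller of the two weights: a move by this share of the segment in either
      direction stays between the endpoints.\<close>
    define s where "s = min u (1 - u)"
    have s: "0 < s" "s \<le> u" "s \<le> 1 - u" using u by (auto simp: s_def)
    have "x + s *\<^sub>R (b - a) = (1 - u - s) *\<^sub>R a + (u + s) *\<^sub>R b"
      "x - s *\<^sub>R (b - a) = (1 - u + s) *\<^sub>R a + (u - s) *\<^sub>R b"
      unfolding u(4) by (simp_all add: algebra_simps)
    then have "x + s *\<^sub>R (b - a) \<in> S" "x - s *\<^sub>R (b - a) \<in> S"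
      using convexD[OF assms ab, of "1 - u - s" "u + s"] convexD[OF assms ab, of "1 - u + s" "u - s"] s u
      by auto
    then have "s *\<^sub>R (b - a) = 0" using x by blast
    then show False using s(1) u(1) by simp
  qed
  then show "x extreme_point_of S" using x by (simp add: extreme_point_of_def)
qed

lemma finite_bounded_int_lattice:
  fixes S :: "(real ^ 'd) set"
  assumes "bounded S" "S \<subseteq> int_lattice"
  shows "finite S"
proof -
  obtain b where b: "\<And>x. x \<in> S \<Longrightarrow> norm x \<le> b" using assms(1) unfolding bounded_iff by blast
  let ?Z = "real_of_int ` {- \<lceil>b\<rceil>..\<lceil>b\<rceil>}"
  have "S \<subseteq> vec_lambda ` (PiE UNIV (\<lambda>_. ?Z))"
  proof
    fix x assume x: "x \<in> S"
    have "x $ i \<in> ?Z" for i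
    proof -
      have "x $ i \<in> \<int>" using assms(2) x by (auto simp: int_lattice_def)
      then obtain z where z: "x $ i = of_int z" by (auto elim: Ints_cases)
      have "\<bar>x $ i\<bar> \<le> b" using component_le_norm_cart[of x i] b[OF x] by linarith
      then have "real_of_int z \<le> b" "- b \<le> real_of_int z" unfolding z by linarith+
      then have "- \<lceil>b\<rceil> \<le> z" "z \<le> \<lceil>b\<rceil>" by linarith+
      then show ?thesis unfolding z by auto
    qed
    then have "vec_nth x \<in> PiE UNIV (\<lambda>_. ?Z)" by blast
    then show "x \<in> vec_lambda ` (PiE UNIV (\<lambda>_. ?Z))" by (metis image_eqI vec_nth_inverse)
  qed
  then show ?thesis by (rule finite_subset) (intro finite_imageI finite_PiE; simp)
qed

text \<open>A bounded set of lattice points is finite, so Krein-Milman yields a polytope without any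
  description by facets.\<close>

lemma convex_integer_polytope_of_extreme_points:
  fixes T :: "(real ^ 'd) set"
  assumes "compact T" "convex T" "{x. x extreme_point_of T} \<subseteq> int_lattice"
  shows "convex_integer_polytope T"
proof -
  have "{x. x extreme_point_of T} \<subseteq> T" by (auto simp: extreme_point_of_def)
  then have "finite {x. x extreme_point_of T}"
    using assms finite_bounded_int_lattice bounded_subset compact_imp_bounded by blast
  then show ?thesis
    using convex_integer_polytope_hull[OF _ assms(3)] Krein_Milman_Minkowski[OF assms(1,2)] by simp
qed

section \<open>Integral level functionals on the cone\<close>

text \<open>\<open>h\<close> is a spacing of levels at which cutting the cone creates lattice
  vertices only. The sections at these levels are recorded too, since the new vertices of a
  truncated complement lie on them.\<close>

definition graded_cone :: "(real ^ 'd) set \<Rightarrow> real ^ 'd \<Rightarrow> nat \<Rightarrow> bool" where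
  "graded_cone C a h \<longleftrightarrow> cone C \<and> convex C \<and> 0 \<in> C \<and> h > 0 \<and> (\<forall>x\<in>C. x \<noteq> 0 \<longrightarrow> 0 < a \<bullet> x) \<and>
     (\<forall>N>0. convex_integer_polytope {x\<in>C. a \<bullet> x \<le> real (N * h)} \<and>
            convex_integer_polytope {x\<in>C. a \<bullet> x = real (N * h)})"

text \<open>Separating the hull from 0 gives a real functional with a uniform margin on
  \<open>V\<close>. After scaling by a large \<open>N\<close> the margin survives rounding to
  integers.\<close>

lemma positive_integer_functional:
  fixes V :: "(real ^ 'd) set"
  assumes "finite V" "0 \<notin> convex hull V"
  shows "\<exists>a\<in>int_lattice. \<forall>v\<in>V. 0 < a \<bullet> v"
proof -
  have "closed (convex hull V)"
    using assms(1) by (intro compact_imp_closed finite_imp_compact_convex_hull)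
  then obtain a b where ab: "0 < b" "\<And>x. x \<in> convex hull V \<Longrightarrow> b < a \<bullet> x"
    using separating_hyperplane_closed_0[of "convex hull V"] assms(2) by auto
  define M where "M = (\<Sum>v\<in>V. norm v)"
  \<comment> \<open>Rounding moves each coordinate by at most 1, hence each value on
    \<open>V\<close> by at most \<open>CARD('d) * M\<close>; the scaled margin \<open>N * b\<close>
    must beat this.\<close>
  obtain N :: nat where N: "real CARD('d) * M / b < real N" using reals_Archimedean2 by blast
  define r :: "real ^ 'd" where "r = (\<chi> i. of_int \<lfloor>real N * a $ i\<rfloor>)"
  have "norm (real N *\<^sub>R a - r) \<le> (\<Sum>i\<in>UNIV. \<bar>(real N *\<^sub>R a - r) $ i\<bar>)" by (rule norm_le_l1_cart)
  also have "\<dots> \<le> (\<Sum>i\<in>(UNIV :: 'd set). 1)"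
  proof (rule sum_mono)
    fix i
    have "\<bar>real N * a $ i - of_int \<lfloor>real N * a $ i\<rfloor>\<bar> \<le> 1" by linarith
    then show "\<bar>(real N *\<^sub>R a - r) $ i\<bar> \<le> 1" by (simp add: r_def)
  qed
  finally have r: "norm (real N *\<^sub>R a - r) \<le> real CARD('d)" by simp
  have "0 < r \<bullet> v" if v: "v \<in> V" for v
  proof -
    have "norm v \<le> M" unfolding M_def using assms(1) v by (intro member_le_sum) auto
    have "(real N *\<^sub>R a - r) \<bullet> v \<le> norm (real N *\<^sub>R a - r) * norm v" by (rule norm_cauchy_schwarz)
    also have "\<dots> \<le> real CARD('d) * M" using r \<open>norm v \<le> M\<close> by (intro mult_mono) auto
    also have "\<dots> < real N * b" using N ab(1) by (simp add: divide_less_eq)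
    also have "\<dots> \<le> real N * (a \<bullet> v)" using ab(2)[OF hull_inc[OF v]] by (intro mult_left_mono) auto
    finally show ?thesis by (simp add: inner_diff_left)
  qed
  moreover have "r \<in> int_lattice" by (simp add: r_def int_lattice_def)
  ultimately show ?thesis by blast
qed

lemma inner_int_lattice: "x \<in> int_lattice \<Longrightarrow> y \<in> int_lattice \<Longrightarrow> x \<bullet> y \<in> \<int>"
  by (auto simp: inner_vec_def int_lattice_def intro!: Ints_sum Ints_mult)

text \<open>\<open>h\<close> is a common multiple of the levels of the generators, so that every level \<open>N * h\<close>
  meets each generating ray in a lattice point.\<close>

lemma graded_cone_exists:
  fixes C :: "(real ^ 'd) set"
  assumes "strictly_convex_cone C" "integer_cone C"
  shows "\<exists>a h. graded_cone C a h"
proof -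
  from assms(1) have cone: "cone C" "convex C" and no_line: "\<And>a u. u \<noteq> 0 \<Longrightarrow> \<not> (\<forall>t::real. a + t *\<^sub>R u \<in> C)"
    unfolding strictly_convex_cone_def by blast+
  have scale: "\<And>c x. 0 \<le> c \<Longrightarrow> x \<in> C \<Longrightarrow> c *\<^sub>R x \<in> C" using cone(1) unfolding cone_def by blast
  from assms(2) obtain W where W: "finite W" "W \<subseteq> int_lattice"
      "C = {(\<Sum>v\<in>W. t v *\<^sub>R v) | t :: real ^ 'd \<Rightarrow> real. \<forall>v\<in>W. 0 \<le> t v}"
    unfolding integer_cone_def by blast
  \<comment> \<open>No functional is positive on a zero generator.\<close>
  define V where "V = W - {0}"
  have V: "finite V" "V \<subseteq> int_lattice" "0 \<notin> V" using W by (auto simp: V_def)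
  have WV: "(\<Sum>v\<in>W. t v *\<^sub>R v) = (\<Sum>v\<in>V. t v *\<^sub>R v)" for t :: "real ^ 'd \<Rightarrow> real"
    unfolding V_def using W(1) by (intro sum.mono_neutral_right) auto
  have C: "x \<in> C \<longleftrightarrow> (\<exists>t. (\<forall>v\<in>V. 0 \<le> t v) \<and> x = (\<Sum>v\<in>V. t v *\<^sub>R v))" for x
  proof
    assume "x \<in> C"
    then show "\<exists>t. (\<forall>v\<in>V. 0 \<le> t v) \<and> x = (\<Sum>v\<in>V. t v *\<^sub>R v)"
      unfolding W(3) using WV V_def by blast
  next
    assume "\<exists>t. (\<forall>v\<in>V. 0 \<le> t v) \<and> x = (\<Sum>v\<in>V. t v *\<^sub>R v)"
    then obtain t where "\<forall>v\<in>V. 0 \<le> t v" "x = (\<Sum>v\<in>V. t v *\<^sub>R v)" by blast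
    then show "x \<in> C" unfolding W(3) mem_Collect_eq WV
      by (intro exI[of _ "\<lambda>v. if v \<in> V then t v else 0"]) auto
  qed
  have zero: "0 \<in> C" unfolding C by (intro exI[of _ "\<lambda>_. 0"]) simp
  have VC: "v \<in> C" if "v \<in> V" for v
    unfolding C using V(1) that
    by (intro exI[of _ "\<lambda>w. if w = v then 1 else 0"]) (simp add: if_distrib[of "\<lambda>c. c *\<^sub>R _"] cong: if_cong)
  \<comment> \<open>A vanishing convex combination has a positive coefficient at some
    \<open>w\<close>. Solving for \<open>w\<close> puts \<open>- w\<close> into \<open>C\<close>,
    and \<open>C\<close> would contain the line spanned by \<open>w\<close>.\<close>
  have "0 \<notin> convex hull V"
  proof
    assume "0 \<in> convex hull V"
    then obtain u where u: "\<forall>v\<in>V. 0 \<le> u v" "sum u V = 1" "(\<Sum>v\<in>V. u v *\<^sub>R v) = 0"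
      unfolding convex_hull_finite[OF V(1)] by blast
    obtain w where w: "w \<in> V" "0 < u w"
      using u(1,2) sum_nonpos[of V u] by (metis not_less zero_less_one)
    have "(\<Sum>v\<in>V - {w}. u v *\<^sub>R v) \<in> C"
      unfolding C by (intro exI[of _ "\<lambda>v. if v = w then 0 else u v"])
        (use u(1) w V(1) in \<open>auto simp: sum.remove[of V w] intro!: sum.cong\<close>)
    moreover have "(\<Sum>v\<in>V - {w}. u v *\<^sub>R v) = - (u w *\<^sub>R w)"
      using u(3) w V(1) by (simp add: sum.remove[of V w] add_eq_0_iff)
    ultimately have "- (u w *\<^sub>R w) \<in> C" by simp
    then have "(1 / u w) *\<^sub>R (- (u w *\<^sub>R w)) \<in> C"
      using w(2) by (intro scale) auto
    moreover have "(1 / u w) *\<^sub>R (- (u w *\<^sub>R w)) = - w" using w by simp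
    ultimately have minus: "- w \<in> C" by simp
    have "0 + t *\<^sub>R w \<in> C" for t
    proof (cases "t \<ge> 0")
      case True
      then show ?thesis using scale VC[OF w(1)] by simp
    next
      case False
      then have "(- t) *\<^sub>R (- w) \<in> C" using minus by (intro scale) auto
      then show ?thesis by simp
    qed
    moreover have "w \<noteq> 0" using w V by blast
    ultimately show False using no_line[of w 0] by blast
  qed
  then obtain a where a: "a \<in> int_lattice" "\<And>v. v \<in> V \<Longrightarrow> 0 < a \<bullet> v"
    using positive_integer_functional[OF V(1)] by blast
  have pos: "0 < a \<bullet> x" if x: "x \<in> C" "x \<noteq> 0" for x
  proof -
    from x(1) obtain t where t: "\<And>v. v \<in> V \<Longrightarrow> 0 \<le> t v" "x = (\<Sum>v\<in>V. t v *\<^sub>R v)" unfolding C by blast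
    have "\<exists>w\<in>V. t w \<noteq> 0"
    proof (rule ccontr)
      assume "\<not> (\<exists>w\<in>V. t w \<noteq> 0)"
      then have "x = 0" unfolding t(2) by (intro sum.neutral) auto
      then show False using x(2) by contradiction
    qed
    then obtain w where w: "w \<in> V" "t w \<noteq> 0" by blast
    have "0 < (\<Sum>v\<in>V. t v * (a \<bullet> v))"
    proof (rule sum_pos2[OF V(1) w(1)])
      show "0 < t w * (a \<bullet> w)" using t(1)[OF w(1)] w(2) a(2)[OF w(1)] by simp
      show "0 \<le> t v * (a \<bullet> v)" if "v \<in> V" for v using t(1)[OF that] a(2)[OF that] by simp
    qed
    then show ?thesis by (simp add: t(2) inner_sum_right)
  qed
  have "(\<Prod>v\<in>V. a \<bullet> v) \<in> \<int>" using a(1) V(2) by (intro Ints_prod) (auto intro: inner_int_lattice)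
  then obtain z where z: "(\<Prod>v\<in>V. a \<bullet> v) = of_int z" by (auto elim: Ints_cases)
  define h where "h = nat z"
  have "0 < (\<Prod>v\<in>V. a \<bullet> v)" using a(2) by (intro prod_pos) auto
  then have h: "real h = (\<Prod>v\<in>V. a \<bullet> v)" "h > 0" unfolding z by (simp_all add: h_def)
  have "convex_integer_polytope {x\<in>C. a \<bullet> x \<le> real (N * h)} \<and>
      convex_integer_polytope {x\<in>C. a \<bullet> x = real (N * h)}" if "N > 0" for N
  proof -
    define L where "L = real (N * h)"
    define e where "e v = (L / (a \<bullet> v)) *\<^sub>R v" for v
    have L: "L > 0" using that h by (simp add: L_def)
    have "L / (a \<bullet> v) \<in> \<int>" if v: "v \<in> V" for v
    proof -
      have "L = real N * ((a \<bullet> v) * (\<Prod>w\<in>V - {v}. a \<bullet> w))"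
        unfolding L_def using h(1) V(1) v by (simp add: prod.remove[of V v])
      then have "L / (a \<bullet> v) = real N * (\<Prod>w\<in>V - {v}. a \<bullet> w)" using a(2)[OF v] by simp
      also have "\<dots> \<in> \<int>" using a(1) V(2) by (intro Ints_mult Ints_prod) (auto intro: inner_int_lattice)
      finally show ?thesis .
    qed
    then have e_int: "e ` V \<subseteq> int_lattice" using V(2) by (auto simp: e_def intro: int_lattice_scale)
    have e_C: "e v \<in> C" "a \<bullet> e v = L" if "v \<in> V" for v
      using VC[OF that] a(2)[OF that] scale L by (auto simp: e_def)
    have level: "x \<in> convex hull (e ` V)" if x: "x \<in> C" "a \<bullet> x = L" for x
    proof -
      from x(1) obtain t where t: "\<And>v. v \<in> V \<Longrightarrow> 0 \<le> t v" "x = (\<Sum>v\<in>V. t v *\<^sub>R v)" unfolding C by blast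
      have "x = (\<Sum>v\<in>V. (t v * (a \<bullet> v) / L) *\<^sub>R e v)"
        unfolding t(2) using a(2) L by (intro sum.cong refl) (auto simp: e_def less_le)
      also have "\<dots> \<in> convex hull (e ` V)"
      proof (rule convex_sum[OF V(1) convex_convex_hull])
        have "(\<Sum>v\<in>V. t v * (a \<bullet> v)) = L" using x(2) by (simp add: t(2) inner_sum_right)
        then show "(\<Sum>v\<in>V. t v * (a \<bullet> v) / L) = 1" using L by (simp flip: sum_divide_distrib)
        show "0 \<le> t v * (a \<bullet> v) / L" if "v \<in> V" for v using t(1) a(2) L that by (simp add: less_imp_le)
      qed (auto intro: hull_inc)
      finally show ?thesis .
    qed
    have "{x\<in>C. a \<bullet> x = L} = convex hull (e ` V)"
    proof
      have "convex (C \<inter> {x. a \<bullet> x = L})" by (intro convex_Int cone convex_hyperplane)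
      then show "convex hull (e ` V) \<subseteq> {x\<in>C. a \<bullet> x = L}"
        using e_C by (intro hull_minimal) (auto simp: Int_def)
    qed (use level in blast)
    moreover have "{x\<in>C. a \<bullet> x \<le> L} = convex hull (insert 0 (e ` V))"
    proof
      have "convex (C \<inter> {x. a \<bullet> x \<le> L})" by (intro convex_Int cone convex_halfspace_le)
      then show "convex hull (insert 0 (e ` V)) \<subseteq> {x\<in>C. a \<bullet> x \<le> L}"
        using e_C zero L by (intro hull_minimal) (auto simp: Int_def)
      show "{x\<in>C. a \<bullet> x \<le> L} \<subseteq> convex hull (insert 0 (e ` V))"
      proof
        fix x assume x: "x \<in> {x\<in>C. a \<bullet> x \<le> L}"
        show "x \<in> convex hull (insert 0 (e ` V))"
        proof (cases "x = 0")
          case False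
          \<comment> \<open>\<open>x\<close> lies on the segment from 0 to the point where its ray
            meets the level \<open>L\<close>, dividing it in the ratio \<open>s\<close>.\<close>
          define s where "s = (a \<bullet> x) / L"
          have s: "0 < s" "s \<le> 1" using x False pos L by (auto simp: s_def)
          have "(1 / s) *\<^sub>R x \<in> convex hull (e ` V)"
          proof (rule level)
            show "(1 / s) *\<^sub>R x \<in> C" using x s scale by simp
            show "a \<bullet> ((1 / s) *\<^sub>R x) = L" using s L by (auto simp: s_def)
          qed
          then have "(1 / s) *\<^sub>R x \<in> convex hull (insert 0 (e ` V))"
            using hull_mono[of "e ` V" "insert 0 (e ` V)" convex] by blast
          moreover have "0 \<in> convex hull (insert 0 (e ` V))" by (simp add: hull_inc)
          ultimately have "s *\<^sub>R ((1 / s) *\<^sub>R x) + (1 - s) *\<^sub>R 0 \<in> convex hull (insert 0 (e ` V))"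
            using s by (intro convexD[OF convex_convex_hull]) auto
          then show ?thesis using s by simp
        qed (simp add: hull_inc)
      qed
    qed
    ultimately show ?thesis
      using V(1) e_int int_lattice_zero unfolding L_def[symmetric]
      by (auto intro!: convex_integer_polytope_hull)
  qed
  then show ?thesis using cone zero h(2) pos unfolding graded_cone_def by blast
qed

lemma graded_coneD:
  assumes "graded_cone C a h"
  shows "cone C" "convex C" "0 \<in> C" "h > 0" "\<And>x. x \<in> C \<Longrightarrow> 0 \<le> a \<bullet> x"
    "\<And>x. x \<in> C \<Longrightarrow> a \<bullet> x = 0 \<Longrightarrow> x = 0"
    "\<And>N. N > 0 \<Longrightarrow> convex_integer_polytope {x\<in>C. a \<bullet> x \<le> real (N * h)}"
    "\<And>N. N > 0 \<Longrightarrow> convex_integer_polytope {x\<in>C. a \<bullet> x = real (N * h)}"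
    "\<And>x y. x \<in> C \<Longrightarrow> y \<in> C \<Longrightarrow> x + y \<in> C"
    "\<And>c x. c \<ge> 0 \<Longrightarrow> x \<in> C \<Longrightarrow> c *\<^sub>R x \<in> C"
proof -
  show *: "cone C" "convex C" "0 \<in> C" "h > 0"
    "\<And>N. N > 0 \<Longrightarrow> convex_integer_polytope {x\<in>C. a \<bullet> x \<le> real (N * h)}"
    "\<And>N. N > 0 \<Longrightarrow> convex_integer_polytope {x\<in>C. a \<bullet> x = real (N * h)}"
    using assms unfolding graded_cone_def by blast+
  show "0 \<le> a \<bullet> x" if "x \<in> C" for x
    using that assms unfolding graded_cone_def by (cases "x = 0") (auto intro: less_imp_le)
  show "x = 0" if "x \<in> C" "a \<bullet> x = 0" for x
    using that assms unfolding graded_cone_def by fastforce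
  show "\<And>x y. x \<in> C \<Longrightarrow> y \<in> C \<Longrightarrow> x + y \<in> C" "\<And>c x. c \<ge> 0 \<Longrightarrow> x \<in> C \<Longrightarrow> c *\<^sub>R x \<in> C"
    using *(1,2) convex_cone[of C] by blast+
qed

section \<open>Truncation commutes with Minkowski sums\<close>

definition truncation :: "real ^ 'd \<Rightarrow> real \<Rightarrow> (real ^ 'd) set \<Rightarrow> (real ^ 'd) set" where
  "truncation a L D = {x\<in>D. a \<bullet> x \<le> L}"

text \<open>Isolates what the truncation formula uses. Both \<open>C\<close> itself and the
  complements of coconvex polytopes qualify, so one formula covers the outer and the inner
  polytopes.\<close>

definition cofinal_above :: "(real ^ 'd) set \<Rightarrow> real ^ 'd \<Rightarrow> real \<Rightarrow> (real ^ 'd) set \<Rightarrow> bool" where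
  "cofinal_above C a L D \<longleftrightarrow> 0 < L \<and> D \<subseteq> C \<and> {x\<in>C. L \<le> a \<bullet> x} \<subseteq> D \<and> (\<forall>y\<in>D. \<forall>c\<in>C. y + c \<in> D)"

lemma cofinal_above_cone:
  "graded_cone C a h \<Longrightarrow> 0 < L \<Longrightarrow> cofinal_above C a L C"
  unfolding cofinal_above_def using graded_coneD(9) by blast

lemma cofinal_above_scale:
  assumes "graded_cone C a h" "cofinal_above C a L D" "0 < m"
  shows "cofinal_above C a (m * L) ((\<lambda>x. m *\<^sub>R x) ` D)"
  unfolding cofinal_above_def
proof (intro conjI ballI subsetI)
  note D = assms(2)[unfolded cofinal_above_def] and C = graded_coneD(10)[OF assms(1)]
  have split: "x = m *\<^sub>R ((1 / m) *\<^sub>R x)" for x :: "real ^ 'a" using assms(3) by simp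
  show "0 < m * L" using D assms(3) by simp
  show "x \<in> C" if "x \<in> (\<lambda>x. m *\<^sub>R x) ` D" for x
    using that D C assms(3) by auto
  show "x \<in> (\<lambda>x. m *\<^sub>R x) ` D" if "x \<in> {x\<in>C. m * L \<le> a \<bullet> x}" for x
  proof -
    have "(1 / m) *\<^sub>R x \<in> D" using that D C[of "1 / m" x] assms(3) by (auto simp: field_simps)
    then show ?thesis using split by blast
  qed
  show "y + c \<in> (\<lambda>x. m *\<^sub>R x) ` D" if "y \<in> (\<lambda>x. m *\<^sub>R x) ` D" "c \<in> C" for y c
  proof -
    obtain z where z: "z \<in> D" "y = m *\<^sub>R z" using \<open>y \<in> (\<lambda>x. m *\<^sub>R x) ` D\<close> by blast
    have "z + (1 / m) *\<^sub>R c \<in> D" using z D \<open>c \<in> C\<close> C[of "1 / m" c] assms(3) by simp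
    moreover have "y + c = m *\<^sub>R (z + (1 / m) *\<^sub>R c)" using z assms(3) by (simp add: scaleR_add_right)
    ultimately show ?thesis by blast
  qed
qed

lemma truncation_scale:
  assumes "0 < m"
  shows "truncation a (m * L) ((\<lambda>x. m *\<^sub>R x) ` D) = (\<lambda>x. m *\<^sub>R x) ` truncation a L D"
  using assms by (auto simp: truncation_def)

text \<open>A point at level at least \<open>L + L'\<close> splits along its own ray in the
  proportion \<open>L : L'\<close>, and each part is high enough for its summand.\<close>

lemma cofinal_above_plus:
  assumes "graded_cone C a h" "cofinal_above C a L D" "cofinal_above C a L' D'"
  shows "cofinal_above C a (L + L') (D + D')"
  unfolding cofinal_above_def
proof (intro conjI ballI subsetI)
  note D = assms(2)[unfolded cofinal_above_def] and D' = assms(3)[unfolded cofinal_above_def]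
    and C = graded_coneD(9,10)[OF assms(1)]
  show "0 < L + L'" using D D' by simp
  show "x \<in> C" if "x \<in> D + D'" for x using that D D' C(1) by (auto elim!: set_plus_elim)
  show "x \<in> D + D'" if x: "x \<in> {x\<in>C. L + L' \<le> a \<bullet> x}" for x
  proof -
    have L: "0 < L" "0 < L'" using D D' by auto
    have "L * (L + L') \<le> L * (a \<bullet> x)" "L' * (L + L') \<le> L' * (a \<bullet> x)"
      using x L by (auto intro: mult_left_mono)
    then have "(L / (L + L')) *\<^sub>R x \<in> D" "(L' / (L + L')) *\<^sub>R x \<in> D'"
      using x L D D' C(2)[of "L / (L + L')" x] C(2)[of "L' / (L + L')" x]
      by (auto simp: pos_le_divide_eq)
    then have "(L / (L + L')) *\<^sub>R x + (L' / (L + L')) *\<^sub>R x \<in> D + D'" by (rule set_plus_intro)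
    moreover have "(L / (L + L')) *\<^sub>R x + (L' / (L + L')) *\<^sub>R x = x"
      using L by (simp flip: scaleR_add_left add_divide_distrib)
    ultimately show ?thesis by simp
  qed
  show "y + c \<in> D + D'" if "y \<in> D + D'" "c \<in> C" for y c
  proof -
    obtain u v where uv: "u \<in> D" "v \<in> D'" "y = u + v" using \<open>y \<in> D + D'\<close> by (rule set_plus_elim)
    then have "u + (v + c) \<in> D + D'" using D' \<open>c \<in> C\<close> by (intro set_plus_intro) auto
    then show ?thesis using uv by (simp add: add.assoc)
  qed
qed

lemma truncation_plus:
  assumes "graded_cone C a h" "cofinal_above C a L D" "cofinal_above C a L' D'"
  shows "truncation a (L + L') (D + D') = truncation a L D + truncation a L' D'"
proof
  show "truncation a L D + truncation a L' D' \<subseteq> truncation a (L + L') (D + D')"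
    by (auto simp: truncation_def inner_add_right elim!: set_plus_elim intro: add_mono set_plus_intro)
  text \<open>If one summand is too high, move the excess along its ray to the other summand.\<close>
  have shift: "\<exists>y' z'. y' \<in> E \<and> a \<bullet> y' \<le> K \<and> z' \<in> E' \<and> a \<bullet> z' \<le> K' \<and> y' + z' = y + z"
    if E: "cofinal_above C a K E" and E': "cofinal_above C a K' E'"
      and yz: "y \<in> E" "z \<in> E'" "a \<bullet> y + a \<bullet> z \<le> K + K'" "a \<bullet> y > K" for E E' K K' y z
  proof -
    note E = E[unfolded cofinal_above_def] and E' = E'[unfolded cofinal_above_def]
      and C = graded_coneD(10)[OF assms(1)]
    \<comment> \<open>Shortens \<open>y\<close> to level exactly \<open>K\<close>, where
      \<open>E\<close> contains all of \<open>C\<close>; the removed part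
      \<open>(1 - s) *\<^sub>R y\<close> lies in \<open>C\<close> and may be added to
      \<open>z\<close>.\<close>
    define s where "s = K / (a \<bullet> y)"
    have s: "0 \<le> s" "s \<le> 1" using E yz(4) by (auto simp: s_def)
    have sy: "a \<bullet> (s *\<^sub>R y) = K" using E yz(4) by (simp add: s_def)
    have yC: "y \<in> C" using yz E by blast
    have "s *\<^sub>R y \<in> E" using E C[OF s(1) yC] sy by auto
    moreover have "z + (1 - s) *\<^sub>R y \<in> E'" using E' yz(2) C[of "1 - s" y] s yC by simp
    moreover have "a \<bullet> (z + (1 - s) *\<^sub>R y) \<le> K'"
      using yz(3) sy by (simp add: inner_add_right left_diff_distrib)
    moreover have "s *\<^sub>R y + (z + (1 - s) *\<^sub>R y) = y + z" by (simp add: algebra_simps)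
    ultimately show ?thesis using sy by (intro exI[of _ "s *\<^sub>R y"] exI[of _ "z + (1 - s) *\<^sub>R y"]) simp
  qed
  show "truncation a (L + L') (D + D') \<subseteq> truncation a L D + truncation a L' D'"
  proof
    fix x assume "x \<in> truncation a (L + L') (D + D')"
    then obtain y z where yz: "y \<in> D" "z \<in> D'" "x = y + z" "a \<bullet> y + a \<bullet> z \<le> L + L'"
      by (auto simp: truncation_def inner_add_right elim!: set_plus_elim)
    consider "a \<bullet> y > L" | "a \<bullet> z > L'" | "a \<bullet> y \<le> L" "a \<bullet> z \<le> L'" by linarith
    then obtain y' z' where "y' \<in> truncation a L D" "z' \<in> truncation a L' D'" "x = y' + z'"
    proof cases
      case 1
      then show ?thesis using shift[OF assms(2,3) yz(1,2,4)] yz(3) that unfolding truncation_def by auto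
    next
      case 2
      have "\<exists>z' y'. z' \<in> D' \<and> a \<bullet> z' \<le> L' \<and> y' \<in> D \<and> a \<bullet> y' \<le> L \<and> z' + y' = z + y"
        using 2 yz by (intro shift[OF assms(3,2)]) auto
      then obtain z' y' where "z' \<in> D'" "a \<bullet> z' \<le> L'" "y' \<in> D" "a \<bullet> y' \<le> L" "z' + y' = z + y" by blast
      then show ?thesis using yz(3) that[of y' z'] unfolding truncation_def by (simp add: add.commute)
    next
      case 3
      then show ?thesis using yz that unfolding truncation_def by auto
    qed
    then show "x \<in> truncation a L D + truncation a L' D'" by (simp add: set_plus_intro)
  qed
qed

text \<open>Cofinality is proved along with the formula because the induction needs it for the
  partial sums.\<close>

lemma truncation_minkowski_sum:
  fixes m :: "'j \<Rightarrow> nat"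
  assumes "graded_cone C a h" "finite J" "J \<noteq> {}" "\<forall>j\<in>J. m j > 0"
    "\<And>j. j \<in> J \<Longrightarrow> cofinal_above C a L (D j)"
  shows "cofinal_above C a (\<Sum>j\<in>J. real (m j) * L) (\<Sum>j\<in>J. (\<lambda>x. real (m j) *\<^sub>R x) ` D j) \<and>
    truncation a (\<Sum>j\<in>J. real (m j) * L) (\<Sum>j\<in>J. (\<lambda>x. real (m j) *\<^sub>R x) ` D j) =
      (\<Sum>j\<in>J. (\<lambda>x. real (m j) *\<^sub>R x) ` truncation a L (D j))"
  using assms(2-)
proof (induction J rule: finite_ne_induct)
  case (singleton j)
  then show ?case using cofinal_above_scale[OF assms(1)] by (simp add: truncation_scale)
next
  case (insert j J)
  have "cofinal_above C a (real (m j) * L) ((\<lambda>x. real (m j) *\<^sub>R x) ` D j)"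
    using insert.prems cofinal_above_scale[OF assms(1)] by simp
  moreover have "truncation a (real (m j) * L) ((\<lambda>x. real (m j) *\<^sub>R x) ` D j) =
      (\<lambda>x. real (m j) *\<^sub>R x) ` truncation a L (D j)"
    using insert.prems by (intro truncation_scale) simp
  ultimately show ?case
    using insert cofinal_above_plus[OF assms(1)] truncation_plus[OF assms(1)] by simp
qed

section \<open>Complements of coconvex polytopes\<close>

text \<open>Far out on the ray from \<open>y\<close> in direction \<open>c\<close> one has left the
  bounded set \<open>C - D\<close>; by convexity everything between \<open>y\<close> and such a
  point is in \<open>D\<close>.\<close>

lemma coconvex_complement_add_cone:
  assumes C: "graded_cone C a h" and D: "coconvex_complement C D" and y: "y \<in> D" and c: "c \<in> C"
  shows "y + c \<in> D"
proof (cases "c = 0")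
  case False
  note D = D[unfolded coconvex_complement_def]
  obtain b where b: "\<And>x. x \<in> C - D \<Longrightarrow> norm x \<le> b" using D unfolding bounded_iff by blast
  \<comment> \<open>Large enough that \<open>y + t *\<^sub>R c\<close> has norm above
    \<open>b\<close>, and at least 1 so that \<open>y + c\<close> is on the segment.\<close>
  define t where "t = max 1 ((b + 1 + norm y) / norm c)"
  have t: "1 \<le> t" by (simp add: t_def)
  have "(b + 1 + norm y) / norm c \<le> t" by (simp add: t_def)
  then have "b + 1 + norm y \<le> norm (t *\<^sub>R c)" using False t by (simp add: divide_le_eq)
  also have "\<dots> \<le> norm (y + t *\<^sub>R c) + norm y"
    using norm_triangle_ineq4[of "y + t *\<^sub>R c" y] by simp
  finally have "b < norm (y + t *\<^sub>R c)" by simp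
  moreover have "y + t *\<^sub>R c \<in> C"
    using y D t c by (intro graded_coneD(9,10)[OF C]) auto
  ultimately have "y + t *\<^sub>R c \<in> D" using b by force
  then have "(1 - 1 / t) *\<^sub>R y + (1 / t) *\<^sub>R (y + t *\<^sub>R c) \<in> D"
    using D y t by (intro convexD) auto
  moreover have "(1 - 1 / t) *\<^sub>R y + (1 / t) *\<^sub>R (y + t *\<^sub>R c) = y + c"
    using t by (simp add: algebra_simps)
  ultimately show ?thesis by simp
qed (use y in simp)

text \<open>Proved for all large \<open>N\<close>, so that several complements can share a
  level.\<close>

lemma coconvex_complement_cofinal_above:
  assumes C: "graded_cone C a h" and D: "coconvex_complement C D"
  shows "\<exists>N0. \<forall>N. N0 \<le> N \<longrightarrow> 0 < N \<longrightarrow> cofinal_above C a (real (N * h)) D"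
proof -
  obtain b where b: "\<And>x. x \<in> C - D \<Longrightarrow> norm x \<le> b"
    using D unfolding coconvex_complement_def bounded_iff by blast
  \<comment> \<open>By Cauchy-Schwarz, \<open>norm a * b\<close> bounds the functional on
    \<open>C - D\<close>; \<open>h > 0\<close> then gives \<open>N0 \<le> N * h\<close>.\<close>
  obtain N0 :: nat where N0: "norm a * b < real N0" using reals_Archimedean2 by blast
  have "cofinal_above C a (real (N * h)) D" if N: "N0 \<le> N" "0 < N" for N
    unfolding cofinal_above_def
  proof (intro conjI ballI subsetI)
    show "0 < real (N * h)" using N graded_coneD(4)[OF C] by simp
    show "x \<in> C" if "x \<in> D" for x using that D by (auto simp: coconvex_complement_def)
    show "x \<in> D" if x: "x \<in> {x\<in>C. real (N * h) \<le> a \<bullet> x}" for x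
    proof (rule ccontr)
      assume "x \<notin> D"
      then have "norm x \<le> b" using x b by blast
      have "a \<bullet> x \<le> norm a * norm x" by (rule norm_cauchy_schwarz)
      also have "\<dots> \<le> norm a * b" using \<open>norm x \<le> b\<close> by (intro mult_left_mono) auto
      also have "\<dots> < real N0" by (rule N0)
      also have "\<dots> \<le> real (N * h)"
      proof -
        have "N0 \<le> N * h" using N graded_coneD(4)[OF C] by (simp add: le_trans[of N0 N])
        then show ?thesis by (simp only: of_nat_le_iff)
      qed
      finally show False using x by simp
    qed
    show "y + c \<in> D" if "y \<in> D" "c \<in> C" for y c
      using coconvex_complement_add_cone[OF C D that] .
  qed
  then show ?thesis by blast
qed

lemma compact_truncation:
  assumes C: "graded_cone C a h" and D: "closed D" "D \<subseteq> C"
  shows "compact (truncation a L D)"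
proof -
  obtain N :: nat where N: "L < real N" using reals_Archimedean2 by blast
  have le: "L \<le> real (Suc N * h)"
  proof -
    have "N \<le> Suc N * h" using graded_coneD(4)[OF C] by (cases h) auto
    then have "real N \<le> real (Suc N * h)" by (simp only: of_nat_le_iff)
    then show ?thesis using N by linarith
  qed
  have "compact {x\<in>C. a \<bullet> x \<le> real (Suc N * h)}"
    using graded_coneD(7)[OF C, of "Suc N"] polytope_imp_compact
    unfolding convex_integer_polytope_def by blast
  moreover have "closed (D \<inter> {x. a \<bullet> x \<le> L})" using D(1) by (intro closed_Int closed_halfspace_le)
  ultimately have "compact ({x\<in>C. a \<bullet> x \<le> real (Suc N * h)} \<inter> (D \<inter> {x. a \<bullet> x \<le> L}))"
    by (rule compact_Int_closed)
  moreover have "{x\<in>C. a \<bullet> x \<le> real (Suc N * h)} \<inter> (D \<inter> {x. a \<bullet> x \<le> L}) = truncation a L D"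
    using D(2) le by (auto simp: truncation_def)
  ultimately show ?thesis by simp
qed

text \<open>An extreme point strictly below the cut is extreme in \<open>D\<close>, since
  extremality is local. One on the cut is extreme in the section of \<open>C\<close>, which
  cofinality places inside the truncation.\<close>

lemma convex_integer_polytope_truncation:
  assumes C: "graded_cone C a h" and D: "coconvex_complement C D"
    and N: "0 < N" "cofinal_above C a (real (N * h)) D"
  shows "convex_integer_polytope (truncation a (real (N * h)) D)"
proof (rule convex_integer_polytope_of_extreme_points)
  let ?L = "real (N * h)"
  let ?T = "truncation a ?L D"
  note D = D[unfolded coconvex_complement_def]
  show "compact ?T" using D by (intro compact_truncation[OF C]) auto
  have "?T = D \<inter> {x. a \<bullet> x \<le> ?L}" by (auto simp: truncation_def)
  then show convex: "convex ?T" using D by (simp add: convex_Int convex_halfspace_le)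
  show "{x. x extreme_point_of ?T} \<subseteq> int_lattice"
  proof
    fix x assume "x \<in> {x. x extreme_point_of ?T}"
    then have ext: "x extreme_point_of ?T" by simp
    then have x: "x \<in> D" "a \<bullet> x \<le> ?L" by (auto simp: extreme_point_of_def truncation_def)
    show "x \<in> int_lattice"
    proof (cases "a \<bullet> x = ?L")
      case True
      let ?F = "{x\<in>C. a \<bullet> x = ?L}"
      have "?F \<subseteq> ?T" using N(2) by (auto simp: cofinal_above_def truncation_def)
      moreover have "x \<in> ?F" using True x D by blast
      ultimately have "x extreme_point_of ?F" using ext unfolding extreme_point_of_def by blast
      then show ?thesis using graded_coneD(8)[OF C N(1)] unfolding convex_integer_polytope_def by blast
    next
      case False
      have "d = 0" if d: "x + d \<in> D" "x - d \<in> D" for d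
      proof -
        \<comment> \<open>Small enough that moving by \<open>\<epsilon> *\<^sub>R d\<close> in
          either direction stays below the cut, and at most 1 so that convexity keeps both points in
          \<open>D\<close>.\<close>
        define \<epsilon> where "\<epsilon> = min 1 ((?L - a \<bullet> x) / (\<bar>a \<bullet> d\<bar> + 1))"
        have \<epsilon>: "0 < \<epsilon>" "\<epsilon> \<le> 1" using False x by (auto simp: \<epsilon>_def)
        have "\<epsilon> \<le> (?L - a \<bullet> x) / (\<bar>a \<bullet> d\<bar> + 1)" by (simp add: \<epsilon>_def)
        then have le: "\<epsilon> * \<bar>a \<bullet> d\<bar> + \<epsilon> \<le> ?L - a \<bullet> x" by (simp add: pos_le_divide_eq distrib_left)
        have "x + \<epsilon> *\<^sub>R d = (1 - \<epsilon>) *\<^sub>R x + \<epsilon> *\<^sub>R (x + d)" "x - \<epsilon> *\<^sub>R d = (1 - \<epsilon>) *\<^sub>R x + \<epsilon> *\<^sub>R (x - d)"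
          by (simp_all add: algebra_simps)
        then have "x + \<epsilon> *\<^sub>R d \<in> D" "x - \<epsilon> *\<^sub>R d \<in> D" using D x d \<epsilon> by (simp_all add: convexD)
        moreover have "\<bar>\<epsilon> * (a \<bullet> d)\<bar> = \<epsilon> * \<bar>a \<bullet> d\<bar>" using \<epsilon> by (simp add: abs_mult)
        ultimately have "x + \<epsilon> *\<^sub>R d \<in> ?T" "x - \<epsilon> *\<^sub>R d \<in> ?T"
          using le \<epsilon> unfolding truncation_def by (auto simp: inner_add_right inner_diff_right)
        then have "\<epsilon> *\<^sub>R d = 0" using ext unfolding extreme_point_of_iff_symmetric[OF convex] by blast
        then show ?thesis using \<epsilon> by simp
      qed
      then have "x extreme_point_of D"
        using x(1) D by (subst extreme_point_of_iff_symmetric) auto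
      then show ?thesis using D by blast
    qed
  qed
qed

text \<open>A sum of closed sets need not be closed. Below the level \<open>L + L\<close> it is a
  sum of compact truncations, above it is all of \<open>C\<close>, so it is a union of two closed
  sets.\<close>

lemma coconvex_complement_plus:
  assumes C: "graded_cone C a h" "closed C" and D: "coconvex_complement C D" and D': "coconvex_complement C D'"
  shows "coconvex_complement C (D + D')"
proof -
  obtain N0 N1 where N: "\<And>N. N0 \<le> N \<Longrightarrow> 0 < N \<Longrightarrow> cofinal_above C a (real (N * h)) D"
    "\<And>N. N1 \<le> N \<Longrightarrow> 0 < N \<Longrightarrow> cofinal_above C a (real (N * h)) D'"
    using coconvex_complement_cofinal_above[OF C(1)] D D' by metis
  define L where "L = real (Suc (N0 + N1) * h)"
  have cof: "cofinal_above C a L D" "cofinal_above C a L D'" unfolding L_def by (rule N; simp)+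
  note plus = cofinal_above_plus[OF C(1) cof, unfolded cofinal_above_def]
  have zero: "0 \<notin> D" "0 \<notin> D'"
    using zero_notin_coconvex_complement graded_coneD(1)[OF C(1)] D D' by blast+
  note D = D[unfolded coconvex_complement_def] and D' = D'[unfolded coconvex_complement_def]
  have "D + D' = truncation a (L + L) (D + D') \<union> {x\<in>C. L + L \<le> a \<bullet> x}"
    using plus by (auto simp: truncation_def)
  then have "D + D' = (truncation a L D + truncation a L D') \<union> (C \<inter> {x. L + L \<le> a \<bullet> x})"
    unfolding truncation_plus[OF C(1) cof] by blast
  moreover have "compact (truncation a L D + truncation a L D')"
    unfolding set_plus_image case_prod_unfold using D D'
    by (intro compact_continuous_image continuous_intros compact_Times compact_truncation[OF C(1)]) auto
  moreover have "closed {x. L + L \<le> a \<bullet> x}" using closed_halfspace_ge[of "L + L" a] by simp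
  ultimately have "closed (D + D')" using C(2) by (metis closed_Int closed_Un compact_imp_closed)
  moreover have convex: "convex (D + D')" using D D' by (intro convex_set_plus) auto
  moreover have "bounded (C - (D + D'))"
  proof (rule bounded_subset)
    show "bounded (truncation a (L + L) C)"
      using C by (intro compact_imp_bounded compact_truncation) auto
    show "C - (D + D') \<subseteq> truncation a (L + L) C"
    proof
      fix x assume "x \<in> C - (D + D')"
      then have "x \<in> C" "\<not> L + L \<le> a \<bullet> x" using plus by blast+
      then show "x \<in> truncation a (L + L) C" by (simp add: truncation_def)
    qed
  qed
  \<comment> \<open>The functional is positive on \<open>C\<close> away from 0, so summands of 0
    would both be 0.\<close>
  moreover have "0 \<notin> D + D'"
  proof
    assume "0 \<in> D + D'"
    then obtain y z where yz: "y \<in> D" "z \<in> D'" "y + z = 0" by (metis set_plus_elim)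
    then have "a \<bullet> y + a \<bullet> z = 0" by (metis inner_add_right inner_zero_right)
    moreover have "y \<in> C" "z \<in> C" using yz D D' by auto
    ultimately have "a \<bullet> y = 0" using graded_coneD(5)[OF C(1)] by (metis add_nonneg_eq_0_iff)
    then have "y = 0" using graded_coneD(6)[OF C(1)] \<open>y \<in> C\<close> by blast
    then show False using yz zero by simp
  qed
  moreover have "{x. x extreme_point_of (D + D')} \<subseteq> int_lattice"
  proof
    fix x assume "x \<in> {x. x extreme_point_of (D + D')}"
    then have "x \<in> D + D'" and ext: "\<And>d. x + d \<in> D + D' \<Longrightarrow> x - d \<in> D + D' \<Longrightarrow> d = 0"
      unfolding mem_Collect_eq extreme_point_of_iff_symmetric[OF convex] by blast+
    then obtain y z where yz: "y \<in> D" "z \<in> D'" "x = y + z" by (metis set_plus_elim)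
    \<comment> \<open>Perturbing one summand perturbs the sum, so both summands of an extreme point
      are extreme.\<close>
    have "d = 0" if "y + d \<in> D" "y - d \<in> D" for d
    proof (rule ext)
      show "x + d \<in> D + D'" using set_plus_intro[OF that(1) yz(2)] yz(3) by (simp add: add_ac)
      show "x - d \<in> D + D'" using set_plus_intro[OF that(2) yz(2)] yz(3) by (simp add: algebra_simps)
    qed
    then have "y extreme_point_of D" using D yz(1) by (subst extreme_point_of_iff_symmetric) auto
    moreover have "d = 0" if "z + d \<in> D'" "z - d \<in> D'" for d
    proof (rule ext)
      show "x + d \<in> D + D'" using set_plus_intro[OF yz(1) that(1)] yz(3) by (simp add: add_ac)
      show "x - d \<in> D + D'" using set_plus_intro[OF yz(1) that(2)] yz(3) by (simp add: algebra_simps)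
    qed
    then have "z extreme_point_of D'" using D' yz(2) by (subst extreme_point_of_iff_symmetric) auto
    ultimately show "x \<in> int_lattice" using D D' yz(3) by (auto intro: int_lattice_add)
  qed
  moreover have "C - (D + D') \<noteq> {}" using \<open>0 \<notin> D + D'\<close> graded_coneD(3)[OF C(1)] by blast
  ultimately show ?thesis using plus unfolding coconvex_complement_def by blast
qed

lemma scale_cone:
  assumes "graded_cone C a h" "0 < (c::real)"
  shows "(\<lambda>x. c *\<^sub>R x) ` C = C"
proof
  show "C \<subseteq> (\<lambda>x. c *\<^sub>R x) ` C"
  proof
    fix x assume "x \<in> C"
    then have "(1 / c) *\<^sub>R x \<in> C" using graded_coneD(10)[OF assms(1), of "1 / c" x] assms(2) by simp
    moreover have "x = c *\<^sub>R ((1 / c) *\<^sub>R x)" using assms(2) by simp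
    ultimately show "x \<in> (\<lambda>x. c *\<^sub>R x) ` C" by blast
  qed
qed (use graded_coneD(10)[OF assms(1), of c] assms(2) in auto)

lemma coconvex_complement_scale:
  fixes m :: nat
  assumes C: "graded_cone C a h" and D: "coconvex_complement C D" and m: "0 < m"
  shows "coconvex_complement C ((\<lambda>x. real m *\<^sub>R x) ` D)"
proof -
  let ?f = "\<lambda>x :: real ^ 'a. real m *\<^sub>R x"
  note D = D[unfolded coconvex_complement_def]
  have inj: "inj ?f" using m by (simp add: inj_def)
  have diff: "C - ?f ` D = ?f ` (C - D)"
    using scale_cone[OF C, of "real m"] m image_set_diff[OF inj, of C D] by simp
  have convex: "convex (?f ` D)" using D by (intro convex_scaling) auto
  have "{x. x extreme_point_of (?f ` D)} \<subseteq> int_lattice"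
  proof
    fix x assume "x \<in> {x. x extreme_point_of (?f ` D)}"
    then have "x \<in> ?f ` D" and ext: "\<And>d. x + d \<in> ?f ` D \<Longrightarrow> x - d \<in> ?f ` D \<Longrightarrow> d = 0"
      unfolding mem_Collect_eq extreme_point_of_iff_symmetric[OF convex] by blast+
    then obtain y where y: "y \<in> D" "x = ?f y" by blast
    have "d = 0" if "y + d \<in> D" "y - d \<in> D" for d
    proof -
      have "x + ?f d \<in> ?f ` D" "x - ?f d \<in> ?f ` D"
        using that unfolding y(2) by (metis image_eqI scaleR_add_right, metis image_eqI scaleR_diff_right)
      then show ?thesis using ext[of "?f d"] m by simp
    qed
    then have "y extreme_point_of D" using D y(1) by (subst extreme_point_of_iff_symmetric) auto
    then show "x \<in> int_lattice" using D y(2) by (auto intro!: int_lattice_scale)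
  qed
  moreover have "closed (?f ` D)" using D by (intro closed_scaling) auto
  moreover have "?f ` D \<subseteq> C" using D scale_cone[OF C, of "real m"] m by auto
  moreover have "bounded (C - ?f ` D)" "C - ?f ` D \<noteq> {}"
    unfolding diff using D by (simp_all add: bounded_scaling)
  ultimately show ?thesis using convex unfolding coconvex_complement_def by blast
qed

lemma coconvex_sum_upto_cong:
  assumes "n \<ge> 1" "\<And>i. i \<in> {1..n} \<Longrightarrow> A i = B i"
  shows "coconvex_sum_upto C n A = coconvex_sum_upto C n B"
proof -
  have "map A [2..<Suc n] = map B [2..<Suc n]" using assms by (intro map_cong refl) auto
  moreover have "A 1 = B 1" using assms by simp
  ultimately show ?thesis unfolding coconvex_sum_upto_def by (simp only:)
qed

text \<open>\<open>complement_of\<close> recovers a complement from its polytope only if it is one,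
  so the partial sums are shown to be complements in the same induction.\<close>

lemma coconvex_sum_upto_eq:
  assumes C: "graded_cone C a h" "closed C" and n: "n \<ge> 1"
    and D: "\<And>i. i \<in> {1..n} \<Longrightarrow> coconvex_complement C (D i)"
  shows "coconvex_complement C (\<Sum>i\<in>{1..n}. D i) \<and>
    coconvex_sum_upto C n (\<lambda>i. C - (D i \<union> {0})) = C - ((\<Sum>i\<in>{1..n}. D i) \<union> {0})"
  using n D
proof (induction n rule: dec_induct)
  case base
  then show ?case by (simp add: coconvex_sum_upto_def)
next
  case (step n)
  then have IH: "coconvex_complement C (\<Sum>i\<in>{1..n}. D i)"
    "coconvex_sum_upto C n (\<lambda>i. C - (D i \<union> {0})) = C - ((\<Sum>i\<in>{1..n}. D i) \<union> {0})" by simp_all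
  have Dn: "coconvex_complement C (D (Suc n))" using step.prems by simp
  have "coconvex_sum_upto C (Suc n) (\<lambda>i. C - (D i \<union> {0})) =
      coconvex_sum C (coconvex_sum_upto C n (\<lambda>i. C - (D i \<union> {0}))) (C - (D (Suc n) \<union> {0}))"
    using step.hyps by (simp add: coconvex_sum_upto_def)
  also have "\<dots> = C - (((\<Sum>i\<in>{1..n}. D i) + D (Suc n)) \<union> {0})"
    unfolding IH(2) coconvex_sum_def
    using complement_of_eq[OF graded_coneD(1)[OF C(1)]] IH(1) Dn by simp
  finally show ?case
    using coconvex_complement_plus[OF C IH(1) Dn] step.hyps by simp
qed

lemma sum_cone:
  assumes C: "graded_cone C a h" and "finite J" "J \<noteq> {}"
  shows "(\<Sum>j\<in>J. C) = C"
  using assms(2,3)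
proof (induction J rule: finite_ne_induct)
  case (insert j J)
  have "C + C = C"
  proof
    show "C \<subseteq> C + C" using set_plus_intro[OF _ graded_coneD(3)[OF C]] by force
  qed (use graded_coneD(9)[OF C] in \<open>auto elim!: set_plus_elim\<close>)
  then show ?case using insert by simp
qed simp

theorem corollary1p2:
  fixes C :: "(real ^ 'd) set"
    and \<mu> :: "(real ^ 'd) set \<Rightarrow> real"
    and A :: "nat \<Rightarrow> (real ^ 'd) set"
    and k n :: nat
  assumes "closed C" and "strictly_convex_cone C" and "integer_cone C"
    and "interior C \<noteq> {}"
    and "polynomial_valuation k \<mu>"
    and "n \<ge> 1"
    and "\<And>i. i \<in> {1..n} \<Longrightarrow> coconvex_integer_polytope C (A i)"
  defines "S \<equiv> \<lambda>m :: nat \<Rightarrow> nat.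
             coconvex_sum_upto C n (\<lambda>i. (\<lambda>a. real (m i) *\<^sub>R a) ` A i)"
  shows "(\<forall>m. (\<forall>i\<in>{1..n}. m i > 0) \<longrightarrow> S m \<in> integer_polytope_ring) \<and>
         polynomial_deg_le_on {1..n} (k + CARD('d)) (\<lambda>m i. real (m i))
           {m. \<forall>i\<in>{1..n}. m i > 0} (\<lambda>m. \<mu> (S m))"
proof -
  let ?J = "{1..n}"
  have J: "finite ?J" "?J \<noteq> {}" using assms(6) by auto
  have \<mu>: "integer_polytope_valuation \<mu>" using assms(5) unfolding polynomial_valuation_def by blast
  obtain a h where C: "graded_cone C a h" using graded_cone_exists[OF assms(2,3)] by blast
  obtain D where D: "\<And>i. i \<in> ?J \<Longrightarrow> coconvex_complement C (D i)" "\<And>i. i \<in> ?J \<Longrightarrow> A i = C - (D i \<union> {0})"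
    using assms(7) unfolding coconvex_integer_polytope_def by metis
  have "\<exists>N0. \<forall>i\<in>?J. \<forall>N. N0 i \<le> N \<longrightarrow> 0 < N \<longrightarrow> cofinal_above C a (real (N * h)) (D i)"
    using coconvex_complement_cofinal_above[OF C D(1)] by (intro bchoice) blast
  then obtain N0 where N0: "\<And>i N. i \<in> ?J \<Longrightarrow> N0 i \<le> N \<Longrightarrow> 0 < N \<Longrightarrow> cofinal_above C a (real (N * h)) (D i)"
    by blast
  \<comment> \<open>Exceeds all thresholds, which gives a common level for all complements;
    \<open>Suc\<close> keeps it positive.\<close>
  define N where "N = Suc (\<Sum>i\<in>?J. N0 i)"
  have N: "0 < N" by (simp add: N_def)
  define L where "L = real (N * h)"
  have "N0 i \<le> N" if "i \<in> ?J" for i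
    using member_le_sum[of i ?J N0] that by (simp add: N_def)
  then have cof: "cofinal_above C a L (D i)" if "i \<in> ?J" for i
    unfolding L_def by (rule N0[OF that _ N]) (use that in blast)
  have "0 < L" using cof[of 1] assms(6) by (simp add: cofinal_above_def)
  note cofC = cofinal_above_cone[OF C this]
  let ?X = "\<lambda>m. \<Sum>i\<in>?J. (\<lambda>x. real (m i) *\<^sub>R x) ` truncation a L C"
  let ?Y = "\<lambda>m. \<Sum>i\<in>?J. (\<lambda>x. real (m i) *\<^sub>R x) ` truncation a L (D i)"
  have TC: "convex_integer_polytope (truncation a L C)"
    using graded_coneD(7)[OF C N] by (simp add: truncation_def L_def)
  have TD: "convex_integer_polytope (truncation a L (D i))" if "i \<in> ?J" for i
    using convex_integer_polytope_truncation[OF C D(1)[OF that] N] cof[OF that] unfolding L_def by blast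
  have ring: "?X m \<in> integer_polytope_ring" "?Y m \<in> integer_polytope_ring" "{0 :: real ^ 'd} \<in> integer_polytope_ring" for m
    using convex_integer_polytope_hull[of "{0 :: real ^ 'd}"] int_lattice_zero
    by (auto intro!: integer_polytope_in_ring convex_integer_polytope_minkowski_sum TC TD)
  \<comment> \<open>The origin is in \<open>?X m\<close> but not in \<open>?Y m\<close>, and the
    coconvex sum omits it, hence the correction by \<open>{0}\<close>.\<close>
  have S: "S m = (?X m - ?Y m) - {0} \<and> ?Y m \<subseteq> ?X m \<and> 0 \<in> ?X m - ?Y m"
    if m: "\<forall>i\<in>?J. m i > 0" for m
  proof -
    let ?mL = "\<Sum>i\<in>?J. real (m i) * L"
    let ?E = "\<Sum>i\<in>?J. (\<lambda>x. real (m i) *\<^sub>R x) ` D i"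
    have mA: "(\<lambda>a. real (m i) *\<^sub>R a) ` A i = C - ((\<lambda>a. real (m i) *\<^sub>R a) ` D i \<union> {0})" if "i \<in> ?J" for i
    proof -
      have "m i > 0" using m that by blast
      then have "inj (\<lambda>a :: real ^ 'd. real (m i) *\<^sub>R a)" by (simp add: inj_def)
      then show ?thesis
        using D(2)[OF that] scale_cone[OF C, of "real (m i)"] m that
        by (simp add: image_set_diff image_Un)
    qed
    have "coconvex_sum_upto C n (\<lambda>i. (\<lambda>a. real (m i) *\<^sub>R a) ` A i) =
        coconvex_sum_upto C n (\<lambda>i. C - ((\<lambda>a. real (m i) *\<^sub>R a) ` D i \<union> {0}))"
      by (rule coconvex_sum_upto_cong[OF assms(6) mA])
    moreover have "coconvex_complement C ?E \<and>
        coconvex_sum_upto C n (\<lambda>i. C - ((\<lambda>a. real (m i) *\<^sub>R a) ` D i \<union> {0})) = C - (?E \<union> {0})"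
      using m D(1) coconvex_complement_scale[OF C] by (intro coconvex_sum_upto_eq[OF C assms(1,6)]) auto
    ultimately have E: "coconvex_complement C ?E" "S m = C - (?E \<union> {0})" unfolding S_def by auto
    have Y: "cofinal_above C a ?mL ?E" "truncation a ?mL ?E = ?Y m"
      using truncation_minkowski_sum[OF C J m, of L D] cof by blast+
    \<comment> \<open>The cone is written as the sum of its own multiples, so that the truncation
      formula for the complements applies to it as well.\<close>
    have "(\<Sum>i\<in>?J. (\<lambda>x. real (m i) *\<^sub>R x) ` C) = (\<Sum>i\<in>?J. C)"
      using m scale_cone[OF C] by (intro sum.cong) auto
    then have X: "truncation a ?mL C = ?X m"
      using truncation_minkowski_sum[OF C J m, of L "\<lambda>_. C"] cofC sum_cone[OF C J] by simp
    have "0 \<notin> ?E" using zero_notin_coconvex_complement[OF graded_coneD(1)[OF C] E(1)] .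
    then show ?thesis
      unfolding X[symmetric] Y(2)[symmetric] E(2) using Y(1) graded_coneD(3)[OF C]
      by (auto simp: cofinal_above_def truncation_def)
  qed
  have "S m \<in> integer_polytope_ring" if "\<forall>i\<in>?J. m i > 0" for m
    using S[OF that] ring by (simp add: integer_polytope_ring_Diff)
  moreover have "polynomial_below ?J (Suc (k + CARD('d))) (\<lambda>m. \<mu> (?X m) - \<mu> (?Y m) - \<mu> {0})"
    using minkowski_sum_polynomial[OF assms(5) J(1)] TC TD
    by (intro polynomial_below_diff polynomial_below_const) auto
  then obtain p where p: "monomial_sum ?J (Suc (k + CARD('d))) p"
    "\<And>m. \<forall>i\<in>?J. m i > 0 \<Longrightarrow> \<mu> (?X m) - \<mu> (?Y m) - \<mu> {0} = p m"
    unfolding polynomial_below_def by blast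
  have "\<mu> (S m) = p m" if m: "\<forall>i\<in>?J. m i > 0" for m
  proof -
    have "\<mu> ((?X m - ?Y m) - {0}) = \<mu> (?X m - ?Y m) - \<mu> {0}"
      using S[OF m] by (intro valuation_Diff[OF \<mu>] integer_polytope_ring_Diff ring) simp
    then have "\<mu> (S m) = \<mu> (?X m - ?Y m) - \<mu> {0}" using S[OF m] by simp
    also have "\<mu> (?X m - ?Y m) = \<mu> (?X m) - \<mu> (?Y m)"
      using S[OF m] by (intro valuation_Diff[OF \<mu>] ring) simp
    finally show ?thesis using p(2)[OF m] by simp
  qed
  then have "polynomial_deg_le_on ?J (k + CARD('d)) (\<lambda>m i. real (m i)) {m. \<forall>i\<in>?J. m i > 0} (\<lambda>m. \<mu> (S m))"
    by (intro monomial_sum_polynomial_deg_le_on[OF p(1) J(1)]) simp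
  ultimately show ?thesis by blast
qed

end
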